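(* For integers $n\ge 2$ and $0\le k\le n-2$, there is a bijection \[ \mathcal{I}_{n,k}(3241,4321)\longrightarrow \mathcal{I}_{n-k}(321)\times \mathcal{C}_{k,\,n-k-2}. \]
   Context: Permutations of $[n]=\{1,\dots,n\}$ are written in one-line notation $p=p_1\cdots p_n$. A permutation avoids a pattern $\sigma$ if it has no subsequence order-isomorphic to $\sigma$. A permutation of $[n]$, $n\ge1$, is indecomposable if there is no $k$ with $1\le k\le n-1$ such that $\{p_1,\dots,p_k\}=\{1,\dots,k\}$. An entry of $p$ is blue if it plays the role of the "2" in some occurrence of the pattern $321$ or of the pattern $4312$ in $p$ (i.e. it is $p_j$ in $p_i>p_j>p_k$ with $i<j<k$, or it is $p_l$ in an occurrence $p_ip_jp_kp_l$, $i<j<k<l$, order-isomorphic to $4312$). $\mathcal{I}_n(3241,4321)$ is the set of indecomposable permutations of $[n]$ avoiding both $3241$ and $4321$, and $\mathcal{I}_{n,k}(3241,4321)$ is the subset of those having exactly $k$ blue entries. $\mathcal{I}_r(321)$ is the set of indecomposable $321$-avoiding permutations of $[r]$. For integers $k,r\ge0$, $\mathcal{C}_{k,r}$ is the set of integer sequences $(a_1,\dots,a_k)$ with $1\le a_1\le r+1$ and $1\le a_i\le a_{i-1}+1$ for $2\le i\le k$ (for $k=0$ it consists of the empty sequence). *)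

theory Defs
  imports Main
begin

text \<open>Permutations of [n] in one-line notation, as lists p with p ! (i-1) = p_i.\<close>
definition perms :: "nat \<Rightarrow> nat list set" where
  "perms n = {p. length p = n \<and> distinct p \<and> set p = {1..n}}"

definition contains :: "nat list \<Rightarrow> nat list \<Rightarrow> bool" where
  "contains p \<sigma> \<longleftrightarrow> (\<exists>idx. length idx = length \<sigma> \<and> sorted_wrt (<) idx \<and>
      (\<forall>t\<in>set idx. t < length p) \<and>
      (\<forall>a<length \<sigma>. \<forall>b<length \<sigma>. (p ! (idx ! a) < p ! (idx ! b)) \<longleftrightarrow> (\<sigma> ! a < \<sigma> ! b)))"

definition avoids :: "nat list \<Rightarrow> nat list \<Rightarrow> bool" where
  "avoids p \<sigma> \<longleftrightarrow> \<not> contains p \<sigma>"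

definition indecomposable :: "nat list \<Rightarrow> bool" where
  "indecomposable p \<longleftrightarrow> length p \<ge> 1 \<and>
     \<not> (\<exists>k. 1 \<le> k \<and> k \<le> length p - 1 \<and> set (take k p) = {1..k})"

text \<open>Position j (0-based) of p carries a blue entry: p_j plays the role of the 2 in
  an occurrence of 321, or of the 2 (last letter) in an occurrence of 4312.\<close>
definition blue_pos :: "nat list \<Rightarrow> nat \<Rightarrow> bool" where
  "blue_pos p j \<longleftrightarrow>
     (\<exists>i k. i < j \<and> j < k \<and> k < length p \<and> p ! i > p ! j \<and> p ! j > p ! k) \<or>
     (\<exists>i j' k. i < j' \<and> j' < k \<and> k < j \<and> j < length p \<and>
        p ! k < p ! j \<and> p ! j < p ! j' \<and> p ! j' < p ! i)"

definition num_blue :: "nat list \<Rightarrow> nat" where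
  "num_blue p = card {j. j < length p \<and> blue_pos p j}"

definition I_3241_4321 :: "nat \<Rightarrow> nat list set" where
  "I_3241_4321 n = {p \<in> perms n. indecomposable p \<and> avoids p [3,2,4,1] \<and> avoids p [4,3,2,1]}"

definition I_3241_4321_k :: "nat \<Rightarrow> nat \<Rightarrow> nat list set" where
  "I_3241_4321_k n k = {p \<in> I_3241_4321 n. num_blue p = k}"

definition I_321 :: "nat \<Rightarrow> nat list set" where
  "I_321 r = {p \<in> perms r. indecomposable p \<and> avoids p [3,2,1]}"

definition C_seq :: "nat \<Rightarrow> nat \<Rightarrow> int list set" where
  "C_seq k r = {a. length a = k \<and> (k > 0 \<longrightarrow> 1 \<le> a ! 0 \<and> a ! 0 \<le> int r + 1) \<and>
      (\<forall>i. 1 \<le> i \<and> i < k \<longrightarrow> 1 \<le> a ! i \<and> a ! i \<le> a ! (i - 1) + 1)}"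

end

theory Submission
  imports Defs
begin

text \<open>
  Call a letter a \<^emph>\<open>two\<close> or a \<^emph>\<open>one\<close> if it is the middle or the last letter of some occurrence of 321.
  Let \<open>y\<close> be the last two and \<open>x\<close> the last one of \<open>p\<close>. Avoidance of 3241 and 4321 forces the letters
  between \<open>y\<close> and \<open>x\<close> to be smaller than \<open>x\<close>, and the letters after \<open>x\<close> to be larger than \<open>y\<close>.
  Delete \<open>y\<close> if it stands directly before \<open>x\<close>, and \<open>x\<close> otherwise: the deleted letter is blue, the
  other letters keep their colour, and the permutation stays indecomposable. Conversely, the
  possible places for a reinsertion are a new bottom letter directly after \<open>x\<close> with value between \<open>x\<close> and
  \<open>y\<close>; a new two directly before \<open>x\<close> with value directly above \<open>y\<close>; or a two that opens a new
  block to the right of \<open>x\<close>, whose value is arbitrary above the minimum of the letters after \<open>x\<close>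
  and which determines its position. Labelling \<open>p\<close> by the number of values above that minimum
  plus \<open>y - x\<close>, a permutation with label \<open>a\<close> has exactly one child with each of the labels
  \<open>1, \<dots>, a + 1\<close>, and this is the rule that generates the sequences in \<open>C_seq\<close>. A 321-avoiding
  permutation of size \<open>m\<close> gets the label \<open>m - 2\<close>.
\<close>

section \<open>Deleting a letter\<close>

text \<open>Permutations are replaced by pairs of a set \<open>S\<close> of positions and a function \<open>f\<close> giving the values,
  so that deleting a letter amounts to removing its position from \<open>S\<close>, without renumbering.\<close>

definition tri :: "nat set \<Rightarrow> (nat \<Rightarrow> nat) \<Rightarrow> nat \<Rightarrow> nat \<Rightarrow> nat \<Rightarrow> bool" where
  "tri S f i j k \<longleftrightarrow> i \<in> S \<and> j \<in> S \<and> k \<in> S \<and> i < j \<and> j < k \<and> f j < f i \<and> f k < f j"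

definition one :: "nat set \<Rightarrow> (nat \<Rightarrow> nat) \<Rightarrow> nat \<Rightarrow> bool" where
  "one S f k \<longleftrightarrow> (\<exists>i j. tri S f i j k)"

definition two :: "nat set \<Rightarrow> (nat \<Rightarrow> nat) \<Rightarrow> nat \<Rightarrow> bool" where
  "two S f j \<longleftrightarrow> (\<exists>i k. tri S f i j k)"

definition blue :: "nat set \<Rightarrow> (nat \<Rightarrow> nat) \<Rightarrow> nat \<Rightarrow> bool" where
  "blue S f l \<longleftrightarrow> two S f l \<or>
     (\<exists>i\<in>S. \<exists>j\<in>S. \<exists>k\<in>S. l \<in> S \<and> i < j \<and> j < k \<and> k < l \<and> f k < f l \<and> f l < f j \<and> f j < f i)"

definition av :: "nat set \<Rightarrow> (nat \<Rightarrow> nat) \<Rightarrow> bool" where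
  "av S f \<longleftrightarrow> (\<forall>i\<in>S. \<forall>j\<in>S. \<forall>k\<in>S. \<forall>l\<in>S. i < j \<and> j < k \<and> k < l \<longrightarrow>
     \<not> (f j < f i \<and> f k < f j \<and> f l < f k) \<and> \<not> (f j < f i \<and> f i < f k \<and> f l < f j))"

text \<open>Here \<open>c\<close> is the first letter after a cut, and the premise on
  \<open>a\<close> leaves out the cut in front of the whole word. Every other cut has to be crossed
  by an inversion; \<open>indecomposable_iff\<close> links this with prefixes.\<close>

definition indec :: "nat set \<Rightarrow> (nat \<Rightarrow> nat) \<Rightarrow> bool" where
  "indec S f \<longleftrightarrow> (\<forall>c\<in>S. (\<exists>a\<in>S. a < c) \<longrightarrow> (\<exists>i\<in>S. \<exists>j\<in>S. i < c \<and> c \<le> j \<and> f j < f i))"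

definition last_one :: "nat set \<Rightarrow> (nat \<Rightarrow> nat) \<Rightarrow> nat \<Rightarrow> bool" where
  "last_one S f x \<longleftrightarrow> one S f x \<and> (\<forall>k. one S f k \<longrightarrow> k \<le> x)"

definition last_two :: "nat set \<Rightarrow> (nat \<Rightarrow> nat) \<Rightarrow> nat \<Rightarrow> bool" where
  "last_two S f y \<longleftrightarrow> two S f y \<and> (\<forall>j. two S f j \<longrightarrow> j \<le> y)"

text \<open>These are the letters that are not left-to-right maxima.\<close>

definition nonrec :: "nat set \<Rightarrow> (nat \<Rightarrow> nat) \<Rightarrow> nat \<Rightarrow> bool" where
  "nonrec S f e \<longleftrightarrow> e \<in> S \<and> (\<exists>c\<in>S. c < e \<and> f e < f c)"

lemma av_4321: "av S f \<Longrightarrow> tri S f i j k \<Longrightarrow> l \<in> S \<Longrightarrow> k < l \<Longrightarrow> f l < f k \<Longrightarrow> False"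
  unfolding av_def tri_def by blast

lemma av_3241: "av S f \<Longrightarrow> tri S f i j l \<Longrightarrow> k \<in> S \<Longrightarrow> j < k \<Longrightarrow> k < l \<Longrightarrow> f i < f k \<Longrightarrow> False"
  unfolding av_def tri_def by blast

text \<open>Both forbidden patterns are a 321 with one extra letter: a smaller letter at the end, or
  a larger letter between the last two.\<close>

lemma avI:
  assumes "\<And>i j k l. tri S f i j k \<Longrightarrow> l \<in> S \<Longrightarrow> k < l \<Longrightarrow> f l < f k \<Longrightarrow> False"
    and "\<And>i j k l. tri S f i j l \<Longrightarrow> k \<in> S \<Longrightarrow> j < k \<Longrightarrow> k < l \<Longrightarrow> f i < f k \<Longrightarrow> False"
  shows "av S f"
  unfolding av_def
proof (intro ballI impI conjI notI)
  fix i j k l assume "i \<in> S" "j \<in> S" "k \<in> S" "l \<in> S" "i < j \<and> j < k \<and> k < l" "f j < f i \<and> f k < f j \<and> f l < f k"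
  then show False using assms(1)[of i j k l] by (simp add: tri_def)
next
  fix i j k l assume "i \<in> S" "j \<in> S" "k \<in> S" "l \<in> S" "i < j \<and> j < k \<and> k < l" "f j < f i \<and> f i < f k \<and> f l < f j"
  then show False using assms(2)[of i j l k] by (simp add: tri_def)
qed

lemma av_mono: "av S f \<Longrightarrow> T \<subseteq> S \<Longrightarrow> av T f"
  unfolding av_def by (meson subsetD)

lemma tri_mono: "tri T f i j k \<Longrightarrow> T \<subseteq> S \<Longrightarrow> tri S f i j k"
  unfolding tri_def by blast

lemma tri_Diff: "tri S f i j k \<Longrightarrow> i \<noteq> d \<Longrightarrow> j \<noteq> d \<Longrightarrow> k \<noteq> d \<Longrightarrow> tri (S - {d}) f i j k"
  unfolding tri_def by blast

text \<open>A cut at any number \<open>t\<close> is the same as the cut at the first element of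
  \<open>S\<close> from \<open>t\<close> on, so \<open>t\<close> may be a position that has been
  deleted.\<close>

lemma indec_cut:
  assumes "indec S f" "i \<in> S" "i < t" "j \<in> S" "t \<le> j"
  obtains i' j' where "i' \<in> S" "j' \<in> S" "i' < t" "t \<le> j'" "f j' < f i'"
proof -
  define c where "c = (LEAST z. z \<in> S \<and> t \<le> z)"
  have c: "c \<in> S \<and> t \<le> c" unfolding c_def by (rule LeastI[of _ j]) (use assms in auto)
  have least: "\<And>z. z \<in> S \<Longrightarrow> t \<le> z \<Longrightarrow> c \<le> z" unfolding c_def by (simp add: Least_le)
  obtain i' j' where ij: "i' \<in> S" "j' \<in> S" "i' < c" "c \<le> j'" "f j' < f i'"
    using assms(1)[unfolded indec_def, rule_format, of c] c assms(2,3) by (meson less_le_trans)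
  then show ?thesis using that[of i' j'] least[of i'] c by (metis le_trans linorder_not_le)
qed

lemma indecI:
  assumes "\<And>t i j. i \<in> S \<Longrightarrow> i < t \<Longrightarrow> j \<in> S \<Longrightarrow> t \<le> j \<Longrightarrow> \<exists>i\<in>S. \<exists>j\<in>S. i < t \<and> t \<le> j \<and> f j < f i"
  shows "indec S f"
  using assms unfolding indec_def by blast

section \<open>The surroundings of the last two and the last one\<close>

locale last_321 =
  fixes S :: "nat set" and f :: "nat \<Rightarrow> nat" and x y :: nat
  assumes av: "av S f" and inj: "inj_on f S"
    and X: "last_one S f x" and Y: "last_two S f y"
begin

lemma neq: "i \<in> S \<Longrightarrow> j \<in> S \<Longrightarrow> i \<noteq> j \<Longrightarrow> f i \<noteq> f j"
  using inj by (auto simp: inj_on_def)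

lemma triD: "tri S f i j k \<Longrightarrow> j \<le> y \<and> k \<le> x"
  using X Y unfolding last_one_def last_two_def one_def two_def by blast

lemma x_in: "x \<in> S" and y_in: "y \<in> S"
  using X Y unfolding last_one_def last_two_def one_def two_def tri_def by blast+

lemma y_less_x: "y < x"
proof -
  obtain c a where "tri S f c y a" using Y unfolding last_two_def two_def by blast
  then show ?thesis using triD[of c y a] by (auto simp: tri_def)
qed

text \<open>The two letters need not come from the same 321. The middle letter \<open>b\<close> of a
  321 ending at \<open>x\<close> stands at or before \<open>y\<close>; if it stood before
  \<open>y\<close> and were larger, then \<open>e b y\<close> and the one belonging to
  \<open>y\<close> would form a 4321.\<close>

lemma fx_less_fy: "f x < f y"
proof -
  obtain c a where 1: "tri S f c y a" using Y unfolding last_two_def two_def by blast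
  obtain e b where 2: "tri S f e b x" using X unfolding last_one_def one_def by blast
  have "b \<le> y" using triD[OF 2] by simp
  moreover have "\<not> f y < f b" if "b < y"
  proof
    assume "f y < f b"
    then have "tri S f e b y" using 2 that y_in by (auto simp: tri_def)
    then show False using av_4321[OF av, of e b y a] 1 by (auto simp: tri_def)
  qed
  ultimately show ?thesis using 2 by (cases "b = y") (auto simp: tri_def)
qed

lemma above_y: obtains c where "c \<in> S" "c < y" "f y < f c"
  using Y unfolding last_two_def two_def tri_def by blast

text \<open>A smaller letter there would complete a 321 with middle \<open>y\<close> that ends after
  the last one.\<close>

lemma after_x: "z \<in> S \<Longrightarrow> x < z \<Longrightarrow> f y < f z"
proof (rule ccontr)
  assume z: "z \<in> S" "x < z" and "\<not> f y < f z"
  then have "f z < f y" using neq[OF y_in z(1)] y_less_x by auto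
  moreover obtain c where "c \<in> S" "c < y" "f y < f c" by (rule above_y)
  ultimately have "tri S f c y z" using z y_in y_less_x by (auto simp: tri_def)
  then show False using triD z by fastforce
qed

text \<open>Let \<open>c\<close> be a larger letter before \<open>y\<close>. A counterexample
  \<open>z\<close> gives the 3241 \<open>c y z x\<close> if it exceeds \<open>c\<close>, and
  otherwise the 321 \<open>c z x\<close> whose middle letter comes after \<open>y\<close>.\<close>

lemma between: "z \<in> S \<Longrightarrow> y < z \<Longrightarrow> z < x \<Longrightarrow> f z < f x"
proof (rule ccontr)
  assume z: "z \<in> S" "y < z" "z < x" and "\<not> f z < f x"
  then have zx: "f x < f z" using neq[OF x_in z(1)] by auto
  obtain c where c: "c \<in> S" "c < y" "f y < f c" by (rule above_y)
  then have t: "tri S f c y x" using x_in y_in y_less_x fx_less_fy by (auto simp: tri_def)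
  then have "f z < f c" using av_3241[OF av t z] neq[OF c(1) z(1)] c z by force
  then have "tri S f c z x" using c z zx x_in by (auto simp: tri_def)
  then show False using triD z by fastforce
qed

text \<open>The letter \<open>w\<close> directly before \<open>x\<close> is smaller than
  \<open>x\<close>, so it can replace \<open>x\<close> at the end of any 321. The letter
  \<open>x\<close> itself is the 2 of the 4312 formed by \<open>c y w x\<close>.\<close>

lemma delete_bottom:
  assumes w: "w \<in> S" "y < w" "w < x" and adj: "\<forall>z\<in>S. \<not> (w < z \<and> z < x)"
  shows "last_321 (S - {x}) f w y"
    and "blue S f x"
    and "j \<noteq> x \<Longrightarrow> blue (S - {x}) f j \<longleftrightarrow> blue S f j"
    and "indec S f \<Longrightarrow> indec (S - {x}) f"
proof -
  obtain c where c: "c \<in> S" "c < y" "f y < f c" by (rule above_y)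
  have wx: "f w < f x" using between w by blast
  have small: "\<not> f z < f x" if "z \<in> S" "x < z" for z
    using after_x[OF that] fx_less_fy by simp
  have t: "tri (S - {x}) f c y w"
    using c w y_in wx fx_less_fy by (auto simp: tri_def)
  have repl: "tri (S - {x}) f i j w" if "tri S f i j x" for i j
    using that triD[OF that] w wx by (auto simp: tri_def)
  show "last_321 (S - {x}) f w y"
  proof
    show "av (S - {x}) f" using av by (rule av_mono) auto
    show "inj_on f (S - {x})" using inj by (rule inj_on_subset) auto
    have "k \<le> w" if "tri (S - {x}) f i j k" for i j k
    proof (rule ccontr)
      assume "\<not> k \<le> w"
      then show False using triD[OF tri_mono[OF that]] adj that by (auto simp: tri_def)
    qed
    then show "last_one (S - {x}) f w" using t unfolding last_one_def one_def by blast
    show "last_two (S - {x}) f y"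
      using t triD[OF tri_mono] unfolding last_two_def two_def by blast
  qed
  show "blue S f x"
    unfolding blue_def using c w y_in x_in wx fx_less_fy by (meson less_trans)
  show "blue (S - {x}) f j \<longleftrightarrow> blue S f j" if jx: "j \<noteq> x"
  proof
    assume "blue (S - {x}) f j"
    then show "blue S f j" unfolding blue_def two_def tri_def by blast
  next
    assume "blue S f j"
    then consider i k where "tri S f i j k"
      | d e a where "d \<in> S" "e \<in> S" "a \<in> S" "j \<in> S" "d < e" "e < a" "a < j" "f a < f j" "f j < f e" "f e < f d"
      unfolding blue_def two_def by blast
    then show "blue (S - {x}) f j"
    proof cases
      case 1
      have "i \<noteq> x" using 1 triD[OF 1] y_less_x by (auto simp: tri_def)
      then have "\<exists>k. tri (S - {x}) f i j k"
        using 1 jx repl tri_Diff[OF 1] by (cases "k = x") blast+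
      then show ?thesis unfolding blue_def two_def by blast
    next
      case 2
      have tr: "tri S f d e a" using 2 by (auto simp: tri_def)
      have "e < x" using triD[OF tr] y_less_x by simp
      \<comment> \<open>If \<open>x\<close> were the 1 of this 4312, its 2 \<open>j\<close> would
        stand further right, and \<open>d e j\<close> would be a 321 ending after the last
        one.\<close>
      moreover have "a \<noteq> x"
      proof
        assume "a = x"
        then have "f y < f j" using after_x 2 by blast
        moreover have "tri S f d e j" using 2 by (auto simp: tri_def)
        ultimately show False using triD[of d e j] 2 \<open>a = x\<close> by auto
      qed
      ultimately have "d \<in> S - {x}" "e \<in> S - {x}" "a \<in> S - {x}" "j \<in> S - {x}"
        using 2 jx by auto
      then show ?thesis using 2 unfolding blue_def by blast
    qed
  qed
  assume ind: "indec S f"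
  show "indec (S - {x}) f"
  proof (rule indecI)
    fix t i j assume i: "i \<in> S - {x}" "i < t" and j: "j \<in> S - {x}" "t \<le> j"
    show "\<exists>i\<in>S - {x}. \<exists>j\<in>S - {x}. i < t \<and> t \<le> j \<and> f j < f i"
    \<comment> \<open>Since \<open>x\<close> has no smaller letter to its right, it can only be the
      lower letter of an inversion. For a cut between \<open>w\<close> and \<open>x\<close>, an
      inversion across the cut after \<open>x\<close> also works; at all other cuts \<open>w\<close>
      can replace \<open>x\<close>.\<close>
    proof (cases "w < t \<and> t \<le> x")
      case True
      then have "x < j" using j adj by force
      then obtain i' j' where ij: "i' \<in> S" "j' \<in> S" "i' < Suc x" "Suc x \<le> j'" "f j' < f i'"
        using indec_cut[OF ind, of i "Suc x" j] i j True by auto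
      have "i' \<noteq> x" using ij small[of j'] by auto
      then have "i' < x" using ij by auto
      then have "i' < t" using adj ij(1) True by force
      then show ?thesis using ij True \<open>i' \<noteq> x\<close> by (intro bexI[of _ i'] bexI[of _ j']) auto
    next
      case False
      obtain i' j' where ij: "i' \<in> S" "j' \<in> S" "i' < t" "t \<le> j'" "f j' < f i'"
        using indec_cut[OF ind, of i t j] i j by auto
      have "i' \<noteq> x" using ij small[of j'] by auto
      show ?thesis
      proof (cases "j' = x")
        case True
        then show ?thesis using ij False w wx \<open>i' \<noteq> x\<close>
          by (intro bexI[of _ i'] bexI[of _ w]) auto
      next
        case False
        then show ?thesis using ij \<open>i' \<noteq> x\<close> by (intro bexI[of _ i'] bexI[of _ j']) auto
      qed
    qed
  qed
qed

text \<open>Now \<open>x\<close> is the only smaller letter to the right of \<open>y\<close>. Hence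
  \<open>y\<close> is not the 3 of a 321, nor the 4 or the 3 of a 4312; and it is not a one, since
  \<open>x\<close> would complete a 4321. So no other letter needs \<open>y\<close> for its
  colour.\<close>

lemma delete_top:
  assumes adj: "\<forall>z\<in>S. \<not> (y < z \<and> z < x)"
  shows "blue S f y"
    and "j \<noteq> y \<Longrightarrow> blue (S - {y}) f j \<longleftrightarrow> blue S f j"
    and "indec S f \<Longrightarrow> indec (S - {y}) f"
proof -
  obtain c where c: "c \<in> S" "c < y" "f y < f c" by (rule above_y)
  have small: "z = x" if "z \<in> S" "y < z" "f z < f y" for z
    using that adj after_x[of z] by (metis less_asym linorder_neqE_nat)
  show "blue S f y" using Y unfolding last_two_def blue_def by blast
  have no1: False if "tri S f i j y" for i j
    using av_4321[OF av that x_in y_less_x fx_less_fy] .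
  show "blue (S - {y}) f j \<longleftrightarrow> blue S f j" if jy: "j \<noteq> y"
  proof
    assume "blue (S - {y}) f j"
    then show "blue S f j" unfolding blue_def two_def tri_def by blast
  next
    assume "blue S f j"
    then consider i k where "tri S f i j k"
      | d e a where "d \<in> S" "e \<in> S" "a \<in> S" "j \<in> S" "d < e" "e < a" "a < j" "f a < f j" "f j < f e" "f e < f d"
      unfolding blue_def two_def by blast
    then show "blue (S - {y}) f j"
    proof cases
      case 1
      have "i \<noteq> y" using triD[OF 1] 1 by (auto simp: tri_def)
      moreover have "k \<noteq> y" using no1 1 by blast
      ultimately show ?thesis using tri_Diff[OF 1 _ jy] unfolding blue_def two_def by blast
    next
      case 2
      have tr: "tri S f d e a" using 2 by (auto simp: tri_def)
      have "d < y" using triD[OF tr] 2 by simp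
      moreover have "a \<noteq> y" using no1 tr by blast
      moreover have "e \<noteq> y"
      proof
        assume "e = y"
        then have "a = x" "j = x" using small[of a] small[of j] 2 by auto
        then show False using 2 by simp
      qed
      ultimately have "d \<in> S - {y}" "e \<in> S - {y}" "a \<in> S - {y}" "j \<in> S - {y}"
        using 2 jy by auto
      then show ?thesis using 2 unfolding blue_def by blast
    qed
  qed
  assume ind: "indec S f"
  show "indec (S - {y}) f"
  proof (rule indecI)
    fix t i j assume i: "i \<in> S - {y}" "i < t" and j: "j \<in> S - {y}" "t \<le> j"
    obtain i' j' where ij: "i' \<in> S" "j' \<in> S" "i' < t" "t \<le> j'" "f j' < f i'"
      using indec_cut[OF ind, of i t j] i j by auto
    show "\<exists>i\<in>S - {y}. \<exists>j\<in>S - {y}. i < t \<and> t \<le> j \<and> f j < f i"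
    proof (cases "i' = y")
      case True
      then have "j' = x" using small ij by auto
      then show ?thesis using ij True c x_in y_less_x fx_less_fy
        by (intro bexI[of _ c] bexI[of _ x]) auto
    next
      case False
      then show ?thesis
      proof (cases "j' = y")
        case True
        then show ?thesis using ij False x_in y_less_x fx_less_fy
          by (intro bexI[of _ i'] bexI[of _ x]) auto
      qed (use ij in blast)
    qed
  qed
qed

end

section \<open>Inserting a letter\<close>

text \<open>The new letter \<open>d\<close> is meant to become the last two and \<open>e\<close> the
  last one. The condition on larger letters says that \<open>f d\<close> is not a new maximum. The
  last condition picks \<open>e\<close> as the largest non-record below \<open>f d\<close>, so that
  the value determines the place.\<close>

definition new_site :: "nat set \<Rightarrow> (nat \<Rightarrow> nat) \<Rightarrow> nat \<Rightarrow> nat \<Rightarrow> bool" where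
  "new_site S f d e \<longleftrightarrow> nonrec S f e \<and> (\<forall>k. one S f k \<longrightarrow> k < e) \<and>
     d < e \<and> (\<forall>z\<in>S. \<not> (d < z \<and> z < e)) \<and>
     f e < f d \<and> (\<exists>z\<in>S. f d < f z) \<and> (\<forall>z. nonrec S f z \<longrightarrow> f z < f d \<longrightarrow> f z \<le> f e)"

text \<open>Cuts between \<open>a\<close> and \<open>d\<close> are crossed by this very pair; all
  other cuts have old letters on both sides, if they have letters there at all.\<close>

lemma indec_insert:
  assumes ind: "indec (S - {d}) f" and d: "d \<in> S" and a: "a \<in> S" "a < d" "f d < f a"
  shows "indec S f"
proof (rule indecI)
  fix t i j assume i: "i \<in> S" "i < t" and j: "j \<in> S" "t \<le> j"
  show "\<exists>i\<in>S. \<exists>j\<in>S. i < t \<and> t \<le> j \<and> f j < f i"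
  proof (cases "a < t \<and> t \<le> d")
    case True
    then show ?thesis using a d by blast
  next
    case False
    have "\<exists>i\<in>S - {d}. i < t" using i a by (intro bexI[of _ "if i = d then a else i"]) auto
    moreover have "\<exists>j\<in>S - {d}. t \<le> j" using j a False by (intro bexI[of _ "if j = d then a else j"]) auto
    ultimately obtain i' j' where "i' \<in> S - {d}" "j' \<in> S - {d}" "i' < t" "t \<le> j'" "f j' < f i'"
      using indec_cut[OF ind] by metis
    then show ?thesis by blast
  qed
qed

lemma last_321I:
  assumes "av S f" "inj_on f S" "tri S f c b x" "tri S f c' y a"
    and "\<And>i j k. tri S f i j k \<Longrightarrow> j \<le> y \<and> k \<le> x"
  shows "last_321 S f x y"
  using assms by unfold_locales (unfold last_one_def last_two_def one_def two_def, blast+)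

text \<open>This reverses \<open>delete_bottom\<close>. All letters after \<open>d\<close> are
  larger than \<open>d\<close>, so \<open>d\<close> occurs in a 321 only as its last letter, where
  \<open>x\<close> can replace it. Forbidden patterns through \<open>d\<close> thus lead back to old
  ones.\<close>

lemma insert_bottom:
  assumes L: "last_321 (S - {d}) f x y" and inj: "inj_on f S" and d: "d \<in> S" "x < d"
    and adj: "\<forall>z\<in>S. \<not> (x < z \<and> z < d)" and fd: "f x < f d" "f d < f y"
  shows "last_321 S f d y" and "indec (S - {d}) f \<Longrightarrow> indec S f"
proof -
  interpret L: last_321 "S - {d}" f x y by (rule L)
  obtain c where c: "c \<in> S - {d}" "c < y" "f y < f c" by (rule L.above_y)
  note xy = L.y_less_x L.fx_less_fy L.x_in L.y_in
  have after: "f d < f z" if "z \<in> S" "d < z" for z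
    using L.after_x[of z] that d fd by auto
  have not_upper: "j \<noteq> d \<and> i \<noteq> d" if "tri S f i j k" for i j k
    using that after[of j] after[of k] by (auto simp: tri_def)
  have repl: "tri (S - {d}) f i j (if k = d then x else k)" if "tri S f i j k" for i j k
  proof (cases "k = d")
    case True
    have "j < d" "j \<in> S" "f d < f j" using that True by (auto simp: tri_def)
    then have "j < x" using adj fd by (metis less_asym linorder_neqE_nat)
    then show ?thesis using that not_upper[OF that] True d fd xy by (auto simp: tri_def)
  qed (use tri_Diff[OF that] not_upper[OF that] in auto)
  have "av S f"
  proof (rule avI)
    fix i j k l assume t: "tri S f i j k" and l: "l \<in> S" "k < l" "f l < f k"
    have kd: "k \<noteq> d" using after[of l] l by auto
    define l' where "l' = (if l = d then x else l)"
    have "tri S f j k l" using t l by (auto simp: tri_def)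
    from repl[OF this] have "tri (S - {d}) f j k l'" by (simp add: l'_def)
    then show False using av_4321[OF L.av, of i j k l'] repl[OF t] kd by (auto simp: tri_def)
  next
    fix i j k l assume t: "tri S f i j l" and k: "k \<in> S" "j < k" "k < l" "f i < f k"
    have kd: "k \<noteq> d" using after[of l] k t by (auto simp: tri_def)
    define l' where "l' = (if l = d then x else l)"
    have "k < l'"
    proof (cases "l = d")
      case True
      have "f d < f k" using t k True by (auto simp: tri_def)
      then have "k < x" using adj fd k True by (metis less_asym linorder_neqE_nat)
      then show ?thesis using True by (simp add: l'_def)
    qed (use k in \<open>simp add: l'_def\<close>)
    then show False using av_3241[OF L.av repl[OF t], of k] k kd by (auto simp: l'_def)
  qed
  moreover have "tri S f c y d" using c xy d fd by (auto simp: tri_def)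
  moreover have "j \<le> y \<and> k \<le> d" if "tri S f i j k" for i j k
    using L.triD[OF repl[OF that]] d by (auto split: if_splits)
  ultimately show "last_321 S f d y" using inj by (intro last_321I) auto
  show "indec (S - {d}) f \<Longrightarrow> indec S f"
    using indec_insert[of S d f y] d fd xy by auto
qed

text \<open>A new two has to be inserted directly in front of the only smaller letter to its right.\<close>

lemma insert_middle:
  assumes av: "av (S - {d}) f" and inj: "inj_on f S" and d: "d \<in> S" and x: "x \<in> S" "d < x" "f x < f d"
    and adj: "\<forall>z\<in>S. \<not> (d < z \<and> z < x)"
    and small: "\<And>z. z \<in> S \<Longrightarrow> d < z \<Longrightarrow> f z < f d \<Longrightarrow> z = x"
    and c: "c \<in> S" "c < d" "f d < f c"
    and no2: "\<And>i j. tri (S - {d}) f i j x \<Longrightarrow> j < d \<Longrightarrow> f d < f j \<Longrightarrow> False"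
    and no4: "\<And>i j. tri (S - {d}) f i j x \<Longrightarrow> j < d \<Longrightarrow> f i < f d \<Longrightarrow> False"
    and last: "\<And>i j k. tri (S - {d}) f i j k \<Longrightarrow> j \<le> d \<and> k \<le> x"
  shows "last_321 S f x d"
proof -
  have below: "f z > f x" if "z \<in> S" "d < z" "z \<noteq> x" for z
    using that small[of z] x by (metis less_trans linorder_neqE_nat inj_onD[OF inj] d nat_neq_iff)
  \<comment> \<open>As \<open>x\<close> is the only smaller letter to the right of \<open>d\<close>,
    the new letter is never the 3 of a 321, and as a 2 it is followed by \<open>x\<close>; as a last
    letter it can be replaced by \<open>x\<close>. Then \<open>no2\<close> forbids \<open>d\<close>
    as the 2 of a 4321, and \<open>no4\<close> forbids it as the 4 of a 3241.\<close>
  have tri_d: "k = x" if "tri S f i d k" for i k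
    using that small by (auto simp: tri_def)
  have tri_d1: False if "tri S f d j k" for j k
    using that small[of j] below[of k] small[of k] by (auto simp: tri_def)
  have tri_d3: "tri (S - {d}) f i j x" if "tri S f i j d" for i j
    using that x by (auto simp: tri_def)
  have "av S f"
  proof (rule avI)
    fix i j k l assume t: "tri S f i j k" and l: "l \<in> S" "k < l" "f l < f k"
    have t': "tri S f j k l" using t l by (auto simp: tri_def)
    have id: "i \<noteq> d" "j \<noteq> d" using tri_d1 t t' by blast+
    show False
    proof (cases "k = d")
      case True
      then show False using no2[OF tri_d3, of i j] t by (auto simp: tri_def)
    next
      case kd: False
      note t0 = tri_Diff[OF t id kd]
      show False
      proof (cases "l = d")
        case True
        then show False using av_4321[OF av t0, of x] t l x id kd by auto
      next
        case False
        then show False using av_4321[OF av t0, of l] l by auto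
      qed
    qed
  next
    fix i j k l assume t: "tri S f i j l" and k: "k \<in> S" "j < k" "k < l" "f i < f k"
    have id: "i \<noteq> d" using tri_d1 t by blast
    have jd: "j \<noteq> d" using tri_d[of i l] t k adj by auto
    show False
    proof (cases "l = d")
      case True
      then show False using av_3241[OF av tri_d3, of i j k] t k x by auto
    next
      case ld: False
      note t0 = tri_Diff[OF t id jd ld]
      show False
      proof (cases "k = d")
        case True
        then have "l = x" using small[of l] t k by (auto simp: tri_def)
        then show False using no4[of i j] t0 k True by auto
      next
        case False
        then show False using av_3241[OF av t0, of k] k by auto
      qed
    qed
  qed
  moreover have "tri S f c d x" using c d x by (auto simp: tri_def)
  moreover have "j \<le> d \<and> k \<le> x" if t: "tri S f i j k" for i j k
  proof -
    consider "j = d" | "k = d" | "i \<noteq> d" "j \<noteq> d" "k \<noteq> d" using tri_d1 t by blast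
    then show ?thesis
    proof cases
      case 1 then show ?thesis using tri_d t by auto
    next
      case 2 then show ?thesis using t x by (auto simp: tri_def)
    next
      case 3 then show ?thesis using last[OF tri_Diff[OF t]] by blast
    qed
  qed
  ultimately show ?thesis using inj by (intro last_321I) auto
qed

text \<open>No value lies between those of \<open>y\<close> and \<open>d\<close>, so
  \<open>y\<close> can replace \<open>d\<close>: a 4321 or a 3241 of the form \<open>i j d x\<close>
  would already be present as \<open>i j y x\<close>.\<close>

lemma insert_top:
  assumes L: "last_321 (S - {d}) f x y" and inj: "inj_on f S" and d: "d \<in> S" "d < x"
    and adj: "\<forall>z\<in>S. \<not> (d < z \<and> z < x)" and fd: "f y < f d" "\<forall>z\<in>S. \<not> (f y < f z \<and> f z < f d)"
  shows "last_321 S f x d" and "indec (S - {d}) f \<Longrightarrow> indec S f"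
proof -
  interpret L: last_321 "S - {d}" f x y by (rule L)
  note xy = L.y_less_x L.fx_less_fy L.x_in L.y_in
  obtain c where c: "c \<in> S - {d}" "c < y" "f y < f c" by (rule L.above_y)
  have yd: "y < d" using adj xy by (metis DiffD1 DiffD2 linorder_neqE_nat singletonI)
  have fc: "f d < f c" using fd c inj d
    by (metis DiffD1 DiffD2 inj_on_contraD insertCI linorder_neqE_nat)
  have pos: "j < y" if "tri (S - {d}) f i j x" "j \<noteq> y" for i j
    using L.triD[OF that(1)] that(2) by auto
  have inc: "f j < f y" if t: "tri (S - {d}) f i j x" and "j \<noteq> y" for i j
  proof (rule ccontr)
    assume "\<not> f j < f y"
    then have "f y < f j" using L.neq[OF L.y_in, of j] t that(2) by (auto simp: tri_def)
    then have "tri (S - {d}) f i j y" using pos[OF that] t xy by (auto simp: tri_def)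
    then show False using av_4321[OF L.av _ L.x_in] xy by blast
  qed
  show "last_321 S f x d"
  proof (rule insert_middle[OF L.av inj d(1) _ d(2) _ adj _ _ _ fc])
    show "z = x" if "z \<in> S" "d < z" "f z < f d" for z
    proof (rule ccontr)
      assume "z \<noteq> x"
      then have "x < z" using adj that by (meson linorder_neqE_nat)
      then have "f y < f z" using L.after_x that by auto
      then show False using fd that by blast
    qed
    show False if t: "tri (S - {d}) f i j x" and "f d < f j" for i j
      using inc[OF t] that fd by (cases "j = y") auto
    show False if t: "tri (S - {d}) f i j x" and "f i < f d" for i j
    proof -
      have i: "i \<in> S - {d}" "f j < f i" "i < j" using t by (auto simp: tri_def)
      have "\<not> f y < f i" using fd i that by blast
      then have "j \<noteq> y" using i by auto
      have "i < y" using i pos[OF t \<open>j \<noteq> y\<close>] by simp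
      then have "f i < f y" using \<open>\<not> f y < f i\<close> L.neq[OF L.y_in i(1)] by auto
      then show False using av_3241[OF L.av t L.y_in pos[OF t \<open>j \<noteq> y\<close>]] xy by simp
    qed
    show "j \<le> d \<and> k \<le> x" if "tri (S - {d}) f i j k" for i j k
      using L.triD[OF that] yd by auto
  qed (use c xy yd fd in auto)
  show "indec (S - {d}) f \<Longrightarrow> indec S f"
    using indec_insert[of S d f c] d fc c yd by auto
qed

text \<open>Letters after \<open>e\<close> exceed \<open>f e\<close>, since otherwise a one would
  come after \<open>e\<close>; by the choice of \<open>e\<close>, the non-records among them exceed
  even \<open>f d\<close>. If no letter before \<open>e\<close> exceeded \<open>f d\<close>, an
  inversion across the cut after \<open>e\<close> would lead from a value below \<open>f d\<close>
  to a non-record above it. Records after \<open>e\<close> exceed the larger letter so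
  obtained.\<close>

lemma new_site_facts:
  assumes av: "av S f" and ind: "indec S f" and inj: "inj_on f (insert d S)" and dS: "d \<notin> S"
    and N: "new_site S f d e"
  shows "\<exists>c\<in>S. c < d \<and> f d < f c" and "z \<in> S \<Longrightarrow> e < z \<Longrightarrow> f d < f z"
proof -
  have eS: "e \<in> S" and de: "d < e" and adj: "\<And>z. z \<in> S \<Longrightarrow> d < z \<Longrightarrow> z < e \<Longrightarrow> False"
    and fe: "f e < f d" and big: "\<exists>z\<in>S. f d < f z"
    and max: "\<And>z. nonrec S f z \<Longrightarrow> f z < f d \<Longrightarrow> f z \<le> f e"
    and ones: "\<And>i j k. tri S f i j k \<Longrightarrow> k < e"
    using N unfolding new_site_def nonrec_def one_def by blast+
  obtain c0 where c0: "c0 \<in> S" "c0 < e" "f e < f c0" using N unfolding new_site_def nonrec_def by blast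
  have dneq: "f z \<noteq> f d" if "z \<in> S" for z using inj dS that by (auto simp: inj_on_def)
  have neq: "f z \<noteq> f w" if "z \<in> S" "w \<in> S" "z \<noteq> w" for z w using inj that by (auto simp: inj_on_def)
  have after: "f e < f z" if "z \<in> S" "e < z" for z
  proof (rule ccontr)
    assume "\<not> f e < f z"
    then have "tri S f c0 e z" using neq[OF eS that(1)] that c0 eS by (auto simp: tri_def)
    then show False using ones that by fastforce
  qed
  have after': "f d < f z" if "nonrec S f z" "e < z" for z
    using max[OF that(1)] after[of z] that dneq[of z] by (force simp: nonrec_def)
  have ex: "\<exists>c\<in>S. c < e \<and> f d < f c"
  proof (rule ccontr)
    assume no: "\<not> ?thesis"
    then obtain z where z: "z \<in> S" "f d < f z" "e < z"
      using big fe by (metis less_asym linorder_neqE_nat)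
    then obtain i j where ij: "i \<in> S" "j \<in> S" "i < Suc e" "Suc e \<le> j" "f j < f i"
      using indec_cut[OF ind eS, of "Suc e" z] by auto
    then have "i \<noteq> e" using after[of j] by auto
    then have "f i < f d" using no ij dneq[of i] by force
    moreover have "nonrec S f j" using ij unfolding nonrec_def by (auto intro!: bexI[of _ i])
    then have "f d < f j" using after'[of j] ij by simp
    ultimately show False using ij by simp
  qed
  then show "\<exists>c\<in>S. c < d \<and> f d < f c" using adj dS by (metis linorder_neqE_nat)
  obtain c where c: "c \<in> S" "c < e" "f d < f c" using ex by blast
  show "f d < f z" if z: "z \<in> S" "e < z"
  proof (cases "nonrec S f z")
    case True then show ?thesis using after' z by blast
  next
    case False
    then have "\<not> f z < f c" using c z unfolding nonrec_def by auto
    then show ?thesis using c by simp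
  qed
qed

text \<open>Before the insertion \<open>e\<close> is not a one, so the conditions \<open>no2\<close>
  and \<open>no4\<close> of \<open>insert_middle\<close> hold vacuously.\<close>

lemma insert_new:
  assumes av: "av (S - {d}) f" and ind: "indec (S - {d}) f" and inj: "inj_on f S" and d: "d \<in> S"
    and N: "new_site (S - {d}) f d e"
  shows "last_321 S f e d" and "indec S f"
proof -
  have inj': "inj_on f (insert d (S - {d}))" using inj d by (simp add: insert_absorb)
  note facts = new_site_facts[OF av ind inj' _ N]
  obtain c where c: "c \<in> S - {d}" "c < d" "f d < f c" using facts(1) by blast
  have eS: "e \<in> S" and de: "d < e" and adj: "\<forall>z\<in>S. \<not> (d < z \<and> z < e)"
    and fe: "f e < f d" and ones: "\<And>i j k. tri (S - {d}) f i j k \<Longrightarrow> k < e"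
    using N unfolding new_site_def nonrec_def one_def by blast+
  show "last_321 S f e d"
  proof (rule insert_middle[OF av inj d eS de fe adj])
    show "z = e" if "z \<in> S" "d < z" "f z < f d" for z
    proof -
      have "\<not> e < z" using facts(2)[of z] that by auto
      then show ?thesis using that adj by (meson linorder_neqE_nat)
    qed
    show "j \<le> d \<and> k \<le> e" if "tri (S - {d}) f i j k" for i j k
    proof -
      have "k < e" using ones that by blast
      moreover have "j \<in> S" "j < k" using that by (auto simp: tri_def)
      ultimately show ?thesis using adj by (meson le_less less_trans not_le_imp_less)
    qed
  qed (use c ones in blast)+
  show "indec S f" using indec_insert[OF ind d] c by blast
qed

context last_321 begin

text \<open>The two outcomes correspond to \<open>insert_top\<close> and \<open>insert_new\<close>;
  which one occurs depends on whether \<open>x\<close> is still a one without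
  \<open>y\<close>.\<close>

lemma delete_top_site:
  assumes adj: "\<forall>z\<in>S. \<not> (y < z \<and> z < x)"
  shows "(\<exists>b. last_321 (S - {y}) f x b \<and> f b < f y \<and> (\<forall>z\<in>S. \<not> (f b < f z \<and> f z < f y)))
    \<or> new_site (S - {y}) f y x"
proof (cases "one (S - {y}) f x")
  case True
  let ?B = "{j. two (S - {y}) f j}"
  have le: "j < y \<and> k \<le> x" if "tri (S - {y}) f i j k" for i j k
    using triD[OF tri_mono[OF that]] that by (auto simp: tri_def le_less)
  then have sub: "?B \<subseteq> {..<y}" by (auto simp: two_def)
  then have fin: "finite ?B" using finite_subset by blast
  define b where "b = Max ?B"
  obtain i0 j0 where ij0: "tri (S - {y}) f i0 j0 x" using True unfolding one_def by blast
  have "?B \<noteq> {}" using ij0 unfolding two_def by blast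
  then have "two (S - {y}) f b" using Max_in[OF fin] by (simp add: b_def)
  moreover have max: "j \<le> b" if "two (S - {y}) f j" for j
    using Max_ge[OF fin] that by (simp add: b_def)
  ultimately have L: "last_321 (S - {y}) f x b"
    using True le av_mono[OF av, of "S - {y}"] inj_on_subset[OF inj, of "S - {y}"]
    by unfold_locales (unfold last_one_def last_two_def one_def, blast+)
  interpret L: last_321 "S - {y}" f x b by (rule L)
  have b_y: "b < y" using \<open>two (S - {y}) f b\<close> sub by auto
  obtain c where c: "c \<in> S - {y}" "c < b" "f b < f c" by (rule L.above_y)
  have bS: "b \<in> S" "b \<noteq> y" using L.y_in by auto
  have tb: "tri S f c b x" using c L.x_in L.y_in L.y_less_x L.fx_less_fy by (auto simp: tri_def)
  have fby: "f b < f y"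
  proof (rule ccontr)
    assume "\<not> f b < f y"
    then have "tri S f c b y" using c b_y bS y_in neq[OF y_in bS(1)] by (auto simp: tri_def)
    then show False using av_4321[OF av _ x_in y_less_x fx_less_fy] by blast
  qed
  \<comment> \<open>Such a \<open>z\<close> would stand before \<open>y\<close>. To the left of
    \<open>b\<close> it gives the 3241 \<open>z b y x\<close>; to the right of \<open>b\<close>,
    either \<open>c b z x\<close> is a 3241 or \<open>c z x\<close> makes \<open>z\<close> a two
    after the last remaining two.\<close>
  have "\<not> (f b < f z \<and> f z < f y)" if z: "z \<in> S" for z
  proof
    assume fz: "f b < f z \<and> f z < f y"
    then have zy: "z \<noteq> y" "z \<noteq> b" by auto
    have "z < y" using fz z zy adj after_x[of z] L.fx_less_fy by (metis less_asym linorder_neqE_nat)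
    show False
    proof (cases "z < b")
      case True
      then have "tri S f z b x" using tb z fz by (auto simp: tri_def)
      then show False using av_3241[OF av _ y_in b_y y_less_x] fz by blast
    next
      case False
      then have bz: "b < z" using zy by simp
      have "z < x" using \<open>z < y\<close> y_less_x by simp
      show False
      proof (cases "f c < f z")
        case True
        then show False using av_3241[OF av tb z bz \<open>z < x\<close>] by blast
      next
        case False
        then have "f z < f c" using neq[of z c] z c bz by auto
        then have "tri (S - {y}) f c z x"
          using c z zy bz \<open>z < x\<close> L.x_in L.fx_less_fy fz by (auto simp: tri_def)
        then show False using max[of z] bz unfolding two_def by fastforce
      qed
    qed
  qed
  then show ?thesis using L fby by blast
next
  case False
  obtain c where c: "c \<in> S" "c < y" "f y < f c" by (rule above_y)
  have "nonrec (S - {y}) f x"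
    using c x_in y_less_x fx_less_fy unfolding nonrec_def by (auto intro!: bexI[of _ c])
  moreover have "k < x" if "one (S - {y}) f k" for k
    using that False triD[OF tri_mono] unfolding one_def by (metis Diff_subset le_less)
  moreover have "\<exists>z\<in>S - {y}. f y < f z" using c by auto
  \<comment> \<open>A non-record with value strictly between those of \<open>x\<close> and
    \<open>y\<close> would stand before \<open>y\<close> and make \<open>x\<close> a one without the
    help of \<open>y\<close>.\<close>
  moreover have "f z \<le> f x" if z: "nonrec (S - {y}) f z" "f z < f y" for z
  proof (rule ccontr)
    assume n: "\<not> f z \<le> f x"
    obtain a where a: "a \<in> S - {y}" "a < z" "f z < f a" and zS: "z \<in> S - {y}"
      using z unfolding nonrec_def by blast
    have "z < y" using n zS adj after_x[of z] z(2)
      by (metis DiffD1 DiffD2 insertI1 less_asym linorder_neqE_nat order_refl)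
    then have "tri (S - {y}) f a z x" using a zS x_in y_less_x n by (auto simp: tri_def)
    then show False using False unfolding one_def by blast
  qed
  ultimately show ?thesis using y_less_x fx_less_fy adj unfolding new_site_def by blast
qed

end

section \<open>Renumbering\<close>

lemma one_in: "one S f k \<Longrightarrow> k \<in> S" and two_in: "two S f k \<Longrightarrow> k \<in> S"
  by (auto simp: one_def two_def tri_def)

lemma blue_in: "blue S f k \<Longrightarrow> k \<in> S"
  by (auto simp: blue_def two_in)

text \<open>All notions above depend only on comparisons of positions and of values, so they are
  carried over by such a \<open>g\<close>. This is how results for \<open>S - {d}\<close> reach a
  properly renumbered permutation.\<close>

locale order_iso =
  fixes S :: "nat set" and f :: "nat \<Rightarrow> nat" and S' :: "nat set" and f' :: "nat \<Rightarrow> nat" and g :: "nat \<Rightarrow> nat"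
  assumes img: "S' = g ` S"
    and pos: "i \<in> S \<Longrightarrow> j \<in> S \<Longrightarrow> g i < g j \<longleftrightarrow> i < j"
    and val: "i \<in> S \<Longrightarrow> j \<in> S \<Longrightarrow> f' (g i) < f' (g j) \<longleftrightarrow> f i < f j"
begin

lemma g_eq: "i \<in> S \<Longrightarrow> j \<in> S \<Longrightarrow> g i = g j \<longleftrightarrow> i = j"
  using pos[of i j] pos[of j i] by (metis linorder_neqE_nat nat_neq_iff)

lemma g_in: "i \<in> S \<Longrightarrow> g i \<in> S'"
  by (simp add: img)

lemma pos_le: "i \<in> S \<Longrightarrow> j \<in> S \<Longrightarrow> g i \<le> g j \<longleftrightarrow> i \<le> j"
  using pos[of j i] by (simp add: linorder_not_less[symmetric])

lemma one_iff: "k \<in> S \<Longrightarrow> one S' f' (g k) \<longleftrightarrow> one S f k"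
  unfolding one_def tri_def img by (auto simp: pos val)

lemma two_iff: "k \<in> S \<Longrightarrow> two S' f' (g k) \<longleftrightarrow> two S f k"
  unfolding two_def tri_def img by (auto simp: pos val)

lemma blue_iff: "k \<in> S \<Longrightarrow> blue S' f' (g k) \<longleftrightarrow> blue S f k"
  unfolding blue_def two_iff unfolding img by (auto simp: pos val)

lemma nonrec_iff: "k \<in> S \<Longrightarrow> nonrec S' f' (g k) \<longleftrightarrow> nonrec S f k"
  unfolding nonrec_def img by (auto simp: pos val)

lemma av_iff: "av S' f' \<longleftrightarrow> av S f"
  unfolding av_def img by (auto simp: pos val)

lemma indec_iff: "indec S' f' \<longleftrightarrow> indec S f"
  unfolding indec_def img by (auto simp: pos val pos_le)

lemma inj_iff: "inj_on f' S' \<longleftrightarrow> inj_on f S"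
proof -
  have "f' (g i) = f' (g j) \<longleftrightarrow> f i = f j" if "i \<in> S" "j \<in> S" for i j
    using val[OF that] val[OF that(2,1)] by (metis linorder_neqE_nat nat_neq_iff)
  then show ?thesis by (auto simp: inj_on_def img g_eq)
qed

lemma last_321_iff: "x \<in> S \<Longrightarrow> y \<in> S \<Longrightarrow> last_321 S' f' (g x) (g y) \<longleftrightarrow> last_321 S f x y"
proof -
  assume x: "x \<in> S" and y: "y \<in> S"
  have "(\<forall>k. one S' f' k \<longrightarrow> k \<le> g x) \<longleftrightarrow> (\<forall>k. one S f k \<longrightarrow> k \<le> x)"
    using x by (metis (no_types, lifting) g_in image_iff img one_iff one_in pos_le)
  moreover have "(\<forall>k. two S' f' k \<longrightarrow> k \<le> g y) \<longleftrightarrow> (\<forall>k. two S f k \<longrightarrow> k \<le> y)"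
    using y by (metis (no_types, lifting) g_in image_iff img two_iff two_in pos_le)
  ultimately show ?thesis
    using x y by (simp add: last_321_def last_one_def last_two_def av_iff inj_iff one_iff two_iff)
qed

end

lemma perms_iff: "p \<in> perms n \<longleftrightarrow> length p = n \<and> distinct p \<and> set p \<subseteq> {1..n}"
proof -
  have "set p = {1..n}" if "length p = n" "distinct p" "set p \<subseteq> {1..n}"
    using that by (intro card_subset_eq) (auto simp: distinct_card)
  then show ?thesis unfolding perms_def by auto
qed

section \<open>Inserting and deleting letters of a list\<close>

definition bump :: "nat \<Rightarrow> nat \<Rightarrow> nat" where
  "bump d i = (if i < d then i else Suc i)"

lemma bump_less [simp]: "bump d i < bump d j \<longleftrightarrow> i < j"
  by (auto simp: bump_def)

lemma bump_eq [simp]: "bump d i = bump d j \<longleftrightarrow> i = j"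
  by (auto simp: bump_def)

lemma bump_neq [simp]: "bump d i \<noteq> d" "d \<noteq> bump d i"
  by (auto simp: bump_def)

text \<open>The increasing map that omits one number is used twice: \<open>bump v\<close> renumbers
  the values here, and \<open>bump d\<close> will describe the shift of the positions.\<close>

definition ins :: "nat list \<Rightarrow> nat \<Rightarrow> nat \<Rightarrow> nat list" where
  "ins q d v = map (bump v) (take d q) @ v # map (bump v) (drop d q)"

definition del :: "nat list \<Rightarrow> nat \<Rightarrow> nat list" where
  "del p d = map (\<lambda>z. if z < p ! d then z else z - 1) (take d p @ drop (Suc d) p)"

lemma bump_surj: "j \<noteq> d \<Longrightarrow> \<exists>i. j = bump d i \<and> (j < Suc n \<longrightarrow> d \<le> n \<longrightarrow> i < n)"
  by (rule exI[of _ "if j < d then j else j - 1"]) (auto simp: bump_def)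

lemma bump_image: "d \<le> n \<Longrightarrow> bump d ` {..<n} = {..<Suc n} - {d}"
proof
  show "{..<Suc n} - {d} \<subseteq> bump d ` {..<n}" if "d \<le> n"
    using bump_surj[of _ d n] that by fastforce
qed (auto simp: bump_def)

lemma length_ins [simp]: "d \<le> length q \<Longrightarrow> length (ins q d v) = Suc (length q)"
  by (simp add: ins_def)

lemma ins_nth_same [simp]: "d \<le> length q \<Longrightarrow> ins q d v ! d = v"
  by (simp add: ins_def nth_append)

lemma ins_nth_bump [simp]: "d \<le> length q \<Longrightarrow> i < length q \<Longrightarrow> ins q d v ! bump d i = bump v (q ! i)"
  by (auto simp: ins_def nth_append bump_def min_def)

lemma ins_perms:
  assumes "q \<in> perms n" "d \<le> n" "1 \<le> v" "v \<le> Suc n"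
  shows "ins q d v \<in> perms (Suc n)"
proof -
  have q: "length q = n" "distinct q" "set q \<subseteq> {1..n}" using assms by (auto simp: perms_iff)
  have "set (take d q) \<inter> set (drop d q) = {}" using q(2) by (rule set_take_disj_set_drop_if_distinct) simp
  then have "distinct (ins q d v)" using q(2)
    by (auto simp: ins_def distinct_map inj_on_def)
  moreover have "set (ins q d v) \<subseteq> {1..Suc n}"
    using q(3) assms(3,4) by (fastforce simp: ins_def bump_def dest: in_set_takeD in_set_dropD)
  ultimately show ?thesis using q assms by (simp add: perms_iff)
qed

lemma del_ins: "d \<le> length q \<Longrightarrow> del (ins q d v) d = q"
proof -
  assume d: "d \<le> length q"
  have "del (ins q d v) d = map (\<lambda>z. if z < v then z else z - 1) (map (bump v) (take d q @ drop d q))"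
    unfolding del_def ins_nth_same[OF d] using d by (simp add: ins_def del: append_take_drop_id)
  also have "\<dots> = map (\<lambda>z. z) (take d q @ drop d q)"
    unfolding map_map by (intro map_cong refl) (auto simp: bump_def)
  finally show ?thesis by simp
qed

lemma ins_del:
  assumes "distinct p" "d < length p"
  shows "ins (del p d) d (p ! d) = p"
proof -
  have e: "p = take d p @ p ! d # drop (Suc d) p" using assms(2) by (simp add: id_take_nth_drop)
  have nin: "p ! d \<notin> set (take d p)" "p ! d \<notin> set (drop (Suc d) p)"
    using assms(1) by (subst (asm) e, auto)+
  have m: "map (\<lambda>z. bump (p ! d) (if z < p ! d then z else z - 1)) xs = xs" if "p ! d \<notin> set xs" for xs
  proof (intro map_idI)
    fix z assume "z \<in> set xs"
    then have "z \<noteq> p ! d" using that by auto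
    then show "bump (p ! d) (if z < p ! d then z else z - 1) = z" by (auto simp: bump_def)
  qed
  show ?thesis unfolding ins_def del_def
    using assms(2) nin m by (simp add: take_map drop_map min_def o_def e[symmetric])
qed

lemma del_perms:
  assumes p: "p \<in> perms (Suc n)" and d: "d \<le> n"
  shows "del p d \<in> perms n"
proof -
  let ?r = "take d p @ drop (Suc d) p"
  have p': "length p = Suc n" "distinct p" "set p \<subseteq> {1..Suc n}" using p by (auto simp: perms_iff)
  have e: "p = take d p @ p ! d # drop (Suc d) p" using p'(1) d by (simp add: id_take_nth_drop)
  have "distinct (take d p @ p ! d # drop (Suc d) p)" using p'(2) e by simp
  then have r: "distinct ?r" "p ! d \<notin> set ?r" by auto
  have sub: "set ?r \<subseteq> {1..Suc n}" using p'(3) by (auto dest: in_set_takeD in_set_dropD)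
  have v: "p ! d \<in> {1..Suc n}" using p'(1,3) d by (simp add: subset_iff)
  have "inj_on (\<lambda>z. if z < p ! d then z else z - 1) (set ?r)"
  proof (rule inj_onI)
    fix a b assume "a \<in> set ?r" "b \<in> set ?r"
      and eq: "(if a < p ! d then a else a - 1) = (if b < p ! d then b else b - 1)"
    then have "a \<noteq> p ! d" "b \<noteq> p ! d" using r(2) by auto
    then show "a = b" using eq by (auto split: if_splits)
  qed
  then have "distinct (del p d)" unfolding del_def distinct_map using r(1) by blast
  moreover have "(if z < p ! d then z else z - 1) \<in> {1..n}" if "z \<in> set ?r" for z
  proof -
    have "z \<noteq> p ! d" using that r(2) by auto
    then show ?thesis using that sub v by fastforce
  qed
  then have "set (del p d) \<subseteq> {1..n}" unfolding del_def set_map by blast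
  moreover have "length (del p d) = n" using p'(1) d by (simp add: del_def)
  ultimately show ?thesis by (simp add: perms_iff)
qed

section \<open>Permutations as lists\<close>

abbreviation idx :: "nat list \<Rightarrow> nat set" where
  "idx p \<equiv> {..<length p}"

lemma blue_pos_iff: "j < length p \<and> blue_pos p j \<longleftrightarrow> blue (idx p) ((!) p) j"
proof -
  have *: "i < length p" if "i < k" "k < length p" for i k using that by simp
  show ?thesis
  proof
    assume "j < length p \<and> blue_pos p j"
    then show "blue (idx p) ((!) p) j"
      unfolding blue_pos_def blue_def two_def tri_def lessThan_iff Bex_def by (meson *)
  next
    assume "blue (idx p) ((!) p) j"
    then show "j < length p \<and> blue_pos p j"
      unfolding blue_pos_def blue_def two_def tri_def lessThan_iff Bex_def by blast
  qed
qed

lemma num_blue_eq: "num_blue p = card {j. blue (idx p) ((!) p) j}"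
  unfolding num_blue_def blue_pos_iff ..

lemma contains_321: "contains p [3, 2, 1] \<longleftrightarrow> (\<exists>k. one (idx p) ((!) p) k)"
proof -
  have pat: "(\<forall>s<3. \<forall>t<3. p ! ([i, j, k] ! s) < p ! ([i, j, k] ! t) \<longleftrightarrow> [3, 2, 1::nat] ! s < [3, 2, 1] ! t)
      \<longleftrightarrow> p ! j < p ! i \<and> p ! k < p ! j" for i j k
    by (auto simp: numeral_3_eq_3 All_less_Suc2)
  show ?thesis
  proof
    assume "contains p [3, 2, 1]"
    then obtain l where l: "length l = 3" "sorted_wrt (<) l" "\<forall>t\<in>set l. t < length p"
      "\<forall>s<3. \<forall>t<3. p ! (l ! s) < p ! (l ! t) \<longleftrightarrow> [3, 2, 1::nat] ! s < [3, 2, 1] ! t"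
      unfolding contains_def by (auto simp: numeral_3_eq_3)
    obtain i j k where "l = [i, j, k]" using l(1) by (auto simp: numeral_3_eq_3 length_Suc_conv)
    then have "tri (idx p) ((!) p) i j k" using l pat[of i j k] by (auto simp: tri_def)
    then show "\<exists>k. one (idx p) ((!) p) k" unfolding one_def by blast
  next
    assume "\<exists>k. one (idx p) ((!) p) k"
    then obtain i j k where "tri (idx p) ((!) p) i j k" unfolding one_def by blast
    then show "contains p [3, 2, 1]" unfolding contains_def using pat[of i j k]
      by (intro exI[of _ "[i, j, k]"]) (simp add: tri_def numeral_3_eq_3)
  qed
qed

lemma contains_4_iff:
  assumes "length \<sigma> = 4"
  shows "contains p \<sigma> \<longleftrightarrow> (\<exists>i j k l. i < j \<and> j < k \<and> k < l \<and> l < length p \<and>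
     (\<forall>s<4. \<forall>t<4. p ! ([i, j, k, l] ! s) < p ! ([i, j, k, l] ! t) \<longleftrightarrow> \<sigma> ! s < \<sigma> ! t))"
proof
  assume "contains p \<sigma>"
  then obtain h where h: "length h = 4" "sorted_wrt (<) h" "\<forall>t\<in>set h. t < length p"
    "\<forall>s<4. \<forall>t<4. p ! (h ! s) < p ! (h ! t) \<longleftrightarrow> \<sigma> ! s < \<sigma> ! t"
    unfolding contains_def using assms by auto
  obtain i j k l where "h = [i, j, k, l]" using h(1) by (auto simp: eval_nat_numeral length_Suc_conv)
  then show "\<exists>i j k l. i < j \<and> j < k \<and> k < l \<and> l < length p \<and>
     (\<forall>s<4. \<forall>t<4. p ! ([i, j, k, l] ! s) < p ! ([i, j, k, l] ! t) \<longleftrightarrow> \<sigma> ! s < \<sigma> ! t)"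
    using h by (intro exI[of _ i] exI[of _ j] exI[of _ k] exI[of _ l]) simp
next
  assume "\<exists>i j k l. i < j \<and> j < k \<and> k < l \<and> l < length p \<and>
     (\<forall>s<4. \<forall>t<4. p ! ([i, j, k, l] ! s) < p ! ([i, j, k, l] ! t) \<longleftrightarrow> \<sigma> ! s < \<sigma> ! t)"
  then obtain i j k l where "i < j" "j < k" "k < l" "l < length p"
     "\<forall>s<4. \<forall>t<4. p ! ([i, j, k, l] ! s) < p ! ([i, j, k, l] ! t) \<longleftrightarrow> \<sigma> ! s < \<sigma> ! t" by blast
  then show "contains p \<sigma>" unfolding contains_def using assms
    by (intro exI[of _ "[i, j, k, l]"]) simp
qed

lemma contains_4321: "contains p [4, 3, 2, 1] \<longleftrightarrow> (\<exists>i j k l. i < j \<and> j < k \<and> k < l \<and> l < length p \<and>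
    p ! j < p ! i \<and> p ! k < p ! j \<and> p ! l < p ! k)"
proof -
  have "(\<forall>s<4. \<forall>t<4. p ! ([i, j, k, l] ! s) < p ! ([i, j, k, l] ! t) \<longleftrightarrow> [4, 3, 2, 1::nat] ! s < [4, 3, 2, 1] ! t)
      \<longleftrightarrow> p ! j < p ! i \<and> p ! k < p ! j \<and> p ! l < p ! k" for i j k l
    by (auto simp: eval_nat_numeral All_less_Suc2)
  then show ?thesis by (subst contains_4_iff) simp_all
qed

lemma contains_3241: "contains p [3, 2, 4, 1] \<longleftrightarrow> (\<exists>i j k l. i < j \<and> j < k \<and> k < l \<and> l < length p \<and>
    p ! j < p ! i \<and> p ! i < p ! k \<and> p ! l < p ! j)"
proof -
  have "(\<forall>s<4. \<forall>t<4. p ! ([i, j, k, l] ! s) < p ! ([i, j, k, l] ! t) \<longleftrightarrow> [3, 2, 4, 1::nat] ! s < [3, 2, 4, 1] ! t)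
      \<longleftrightarrow> p ! j < p ! i \<and> p ! i < p ! k \<and> p ! l < p ! j" for i j k l
    by (auto simp: eval_nat_numeral All_less_Suc2)
  then show ?thesis by (subst contains_4_iff) simp_all
qed

lemma av_iff_avoids: "av (idx p) ((!) p) \<longleftrightarrow> avoids p [3, 2, 4, 1] \<and> avoids p [4, 3, 2, 1]"
proof
  assume av: "av (idx p) ((!) p)"
  have "i \<in> idx p \<and> j \<in> idx p \<and> k \<in> idx p" if "i < j" "j < k" "k < l" "l < length p" for i j k l
    using that by auto
  then show "avoids p [3, 2, 4, 1] \<and> avoids p [4, 3, 2, 1]"
    using av unfolding avoids_def contains_3241 contains_4321 av_def by (meson lessThan_iff)
next
  assume "avoids p [3, 2, 4, 1] \<and> avoids p [4, 3, 2, 1]"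
  then show "av (idx p) ((!) p)"
    unfolding avoids_def contains_3241 contains_4321 av_def by (meson lessThan_iff)
qed

lemma indecomposable_iff:
  assumes "p \<in> perms n"
  shows "indecomposable p \<longleftrightarrow> n \<ge> 1 \<and> indec (idx p) ((!) p)"
proof -
  have p: "length p = n" "distinct p" "set p = {1..n}" using assms by (auto simp: perms_def)
  have "set (take k p) = {1..k} \<longleftrightarrow> \<not> (\<exists>i<n. \<exists>j<n. i < k \<and> k \<le> j \<and> p ! j < p ! i)" if k: "k < n" for k
  proof
    assume eq: "set (take k p) = {1..k}"
    show "\<not> (\<exists>i<n. \<exists>j<n. i < k \<and> k \<le> j \<and> p ! j < p ! i)"
    proof clarify
      fix i j assume ij: "i < n" "j < n" "i < k" "k \<le> j" "p ! j < p ! i"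
      have "p ! i \<in> set (take k p)" using ij p(1) by (auto simp: in_set_conv_nth intro!: exI[of _ i])
      then have "p ! j \<in> {1..k}" using eq ij p(1,3) nth_mem[of j p] by auto
      then have "p ! j \<in> set (take k p)" using eq by simp
      then obtain i' where "i' < k" "p ! i' = p ! j" using k p(1) by (auto simp: in_set_conv_nth)
      then show False using p(1,2) ij nth_eq_iff_index_eq[of p i' j] by auto
    qed
  next
    assume no: "\<not> (\<exists>i<n. \<exists>j<n. i < k \<and> k \<le> j \<and> p ! j < p ! i)"
    let ?A = "set (take k p)"
    have card: "card ?A = k" using p k by (simp add: distinct_card)
    have "?A \<subseteq> {1..k}"
    proof
      fix a assume a: "a \<in> ?A"
      then obtain i where i: "i < k" "a = p ! i" using k p(1) by (auto simp: in_set_conv_nth)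
      \<comment> \<open>Without an inversion across the cut, all values below a letter
        \<open>a\<close> of the prefix lie in the prefix too. Hence \<open>a\<close> is at most the
        size \<open>k\<close> of the prefix.\<close>
      have "{1..a} \<subseteq> ?A"
      proof
        fix b assume b: "b \<in> {1..a}"
        have "a \<in> {1..n}" using a p(3) by (auto dest: in_set_takeD)
        then have "b \<in> set p" using b p(3) by auto
        then obtain j where j: "j < n" "b = p ! j" using p(1) by (auto simp: in_set_conv_nth)
        show "b \<in> ?A"
        proof (cases "j < k")
          case True then show ?thesis using j p(1) by (auto simp: in_set_conv_nth intro!: exI[of _ j])
        next
          case False
          then have "\<not> p ! j < p ! i" using no i j k by force
          then have "b = a" using b i j by auto
          then show ?thesis using a by simp
        qed
      qed
      then have "card {1..a} \<le> card ?A" by (intro card_mono) auto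
      then show "a \<in> {1..k}" using card a p(3) by (auto dest: in_set_takeD)
    qed
    then show "?A = {1..k}" using card by (intro card_subset_eq) auto
  qed
  note cut = this
  have "(\<exists>k. 1 \<le> k \<and> k \<le> length p - 1 \<and> set (take k p) = {1..k}) \<longleftrightarrow> \<not> indec (idx p) ((!) p)"
    if "n \<ge> 1"
  proof
    assume "\<exists>k. 1 \<le> k \<and> k \<le> length p - 1 \<and> set (take k p) = {1..k}"
    then obtain k where k: "1 \<le> k" "k < n" "set (take k p) = {1..k}" using p(1) that by force
    show "\<not> indec (idx p) ((!) p)"
    proof
      assume "indec (idx p) ((!) p)"
      from this[unfolded indec_def, rule_format, of k]
      have "\<exists>i\<in>idx p. \<exists>j\<in>idx p. i < k \<and> k \<le> j \<and> p ! j < p ! i"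
        using k(1,2) p(1) by force
      then show False using cut[OF k(2)] k(3) p(1) by auto
    qed
  next
    assume "\<not> indec (idx p) ((!) p)"
    then obtain k a where k: "k < n" "a < k" "\<not> (\<exists>i<n. \<exists>j<n. i < k \<and> k \<le> j \<and> p ! j < p ! i)"
      unfolding indec_def using p(1) by auto
    then have "1 \<le> k \<and> k \<le> length p - 1 \<and> set (take k p) = {1..k}" using cut[OF k(1)] p(1) by simp
    then show "\<exists>k. 1 \<le> k \<and> k \<le> length p - 1 \<and> set (take k p) = {1..k}" by blast
  qed
  then show ?thesis unfolding indecomposable_def using p(1) by auto
qed

lemma nonrec_in: "nonrec S f k \<Longrightarrow> k \<in> S"
  by (simp add: nonrec_def)

lemma perms_inj: "p \<in> perms n \<Longrightarrow> inj_on ((!) p) (idx p)"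
  by (auto simp: perms_def inj_on_def nth_eq_iff_index_eq)

lemma class_iff:
  assumes "p \<in> perms n"
  shows "p \<in> I_3241_4321_k n k \<longleftrightarrow> n \<ge> 1 \<and> av (idx p) ((!) p) \<and> indec (idx p) ((!) p) \<and> num_blue p = k"
  using assms indecomposable_iff[OF assms] av_iff_avoids[of p]
  unfolding I_3241_4321_k_def I_3241_4321_def by auto

section \<open>The label, the removable letter and the insertion sites\<close>

definition last1 :: "nat list \<Rightarrow> nat" where
  "last1 p = (GREATEST k. one (idx p) ((!) p) k)"

definition last2 :: "nat list \<Rightarrow> nat" where
  "last2 p = (GREATEST j. two (idx p) ((!) p) j)"

text \<open>If nothing follows position \<open>x\<close>, the value is \<open>length p\<close>, above which there are no entries.\<close>

definition min_after :: "nat list \<Rightarrow> nat \<Rightarrow> nat" where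
  "min_after p x = (if Suc x < length p then Min (set (drop (Suc x) p)) else length p)"

definition label :: "nat list \<Rightarrow> nat" where
  "label p = (if contains p [3, 2, 1]
     then length p - min_after p (last1 p) + (p ! last2 p - p ! last1 p) else length p - 2)"

definition removable :: "nat list \<Rightarrow> nat" where
  "removable p = (if last1 p = Suc (last2 p) then last2 p else last1 p)"

lemma last_eq:
  assumes "last_321 (idx p) ((!) p) x y"
  shows "last1 p = x" "last2 p = y" "contains p [3, 2, 1]"
proof -
  interpret last_321 "idx p" "(!) p" x y by (rule assms)
  show "last1 p = x" unfolding last1_def using X by (intro Greatest_equality) (auto simp: last_one_def)
  show "last2 p = y" unfolding last2_def using Y by (intro Greatest_equality) (auto simp: last_two_def)
  show "contains p [3, 2, 1]" using X unfolding contains_321 last_one_def by blast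
qed

lemma last_321_exists:
  assumes av: "av (idx p) ((!) p)" and inj: "inj_on ((!) p) (idx p)" and c: "contains p [3, 2, 1]"
  shows "last_321 (idx p) ((!) p) (last1 p) (last2 p)"
proof -
  have bd: "k \<le> length p" if "one (idx p) ((!) p) k \<or> two (idx p) ((!) p) k" for k
    using that one_in two_in by fastforce
  obtain k where k: "one (idx p) ((!) p) k" using c contains_321 by blast
  then obtain j where j: "two (idx p) ((!) p) j" unfolding one_def two_def by blast
  show ?thesis
  proof
    show "last_one (idx p) ((!) p) (last1 p)"
      unfolding last_one_def last1_def
      using GreatestI_nat[of "one (idx p) ((!) p)", OF k] Greatest_le_nat[of "one (idx p) ((!) p)"] bd by blast
    show "last_two (idx p) ((!) p) (last2 p)"
      unfolding last_two_def last2_def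
      using GreatestI_nat[of "two (idx p) ((!) p)", OF j] Greatest_le_nat[of "two (idx p) ((!) p)"] bd by blast
  qed (fact av inj)+
qed

text \<open>Sites are pairs of a position and a value, as \<open>ins\<close> takes them. The upper
  end of the interval is included because inserting \<open>v\<close> lifts the old value
  \<open>v\<close>, so the last two stays above the new letter.\<close>

definition bottom_sites :: "nat list \<Rightarrow> (nat \<times> nat) set" where
  "bottom_sites q = Pair (Suc (last1 q)) ` {q ! last1 q <.. q ! last2 q}"

text \<open>This is \<open>new_site\<close> in terms of the old permutation: the new letter takes
  position \<open>e\<close>, and the old letter there moves one step to the right. The bound
  \<open>length q\<close> keeps \<open>v\<close> from becoming the new maximum.\<close>

definition new_sites :: "nat list \<Rightarrow> (nat \<times> nat) set" where
  "new_sites q = {(e, v). nonrec (idx q) ((!) q) e \<and> (\<forall>k. one (idx q) ((!) q) k \<longrightarrow> k < e) \<and>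
     q ! e < v \<and> v \<le> length q \<and> (\<forall>z. nonrec (idx q) ((!) q) z \<longrightarrow> q ! z < v \<longrightarrow> q ! z \<le> q ! e)}"

definition sites :: "nat list \<Rightarrow> (nat \<times> nat) set" where
  "sites q = new_sites q \<union> (if contains q [3, 2, 1]
     then bottom_sites q \<union> {(last1 q, Suc (q ! last2 q))} else {})"

lemma bump_val_less: "bump v a < v \<longleftrightarrow> a < v" and bump_val_greater: "v < bump v a \<longleftrightarrow> v \<le> a"
  by (auto simp: bump_def)

section \<open>The effect of a single insertion\<close>

locale insertion =
  fixes q p :: "nat list" and n d v :: nat
  assumes q: "q \<in> perms n" and d: "d \<le> n" and v: "1 \<le> v" "v \<le> Suc n" and p: "p = ins q d v"
begin

lemma len: "length q = n" "length p = Suc n"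
  using q d by (auto simp: perms_def p)

lemma p_perms: "p \<in> perms (Suc n)"
  unfolding p using q d v by (rule ins_perms)

lemma nth_bump: "i < n \<Longrightarrow> p ! bump d i = bump v (q ! i)"
  using d len by (simp add: p)

lemma nth_d: "p ! d = v"
  using d len by (simp add: p)

lemma d_in: "d \<in> idx p"
  using d len by simp

sublocale iso: order_iso "idx q" "(!) q" "idx p - {d}" "(!) p" "bump d"
proof
  show "idx p - {d} = bump d ` idx q" using bump_image[OF d] len by simp
qed (use len in \<open>auto simp: nth_bump\<close>)

lemma val_bounds: "i < n \<Longrightarrow> 1 \<le> q ! i \<and> q ! i \<le> n"
  using q nth_mem[of i q] by (auto simp: perms_def)

lemma num_blue_insertion:
  assumes "blue (idx p) ((!) p) d"
    and "\<And>j. j \<noteq> d \<Longrightarrow> blue (idx p - {d}) ((!) p) j \<longleftrightarrow> blue (idx p) ((!) p) j"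
  shows "num_blue p = Suc (num_blue q)"
proof -
  let ?B = "{j. blue (idx q) ((!) q) j}"
  have fin: "finite ?B" by (rule finite_subset[of _ "idx q"]) (auto dest: blue_in)
  have "{j. blue (idx p) ((!) p) j} = insert d (bump d ` ?B)"
  proof (intro set_eqI iffI)
    fix j assume "j \<in> {j. blue (idx p) ((!) p) j}"
    then have b: "blue (idx p) ((!) p) j" by simp
    show "j \<in> insert d (bump d ` ?B)"
    proof (cases "j = d")
      case False
      then have b': "blue (idx p - {d}) ((!) p) j" using assms(2) b by simp
      then obtain i where "i \<in> idx q" "j = bump d i" using blue_in[OF b'] iso.img by blast
      then show ?thesis using b' iso.blue_iff by auto
    qed simp
  next
    fix j assume "j \<in> insert d (bump d ` ?B)"
    then show "j \<in> {j. blue (idx p) ((!) p) j}"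
    proof
      assume "j \<in> bump d ` ?B"
      then obtain i where i: "blue (idx q) ((!) q) i" "j = bump d i" by auto
      then have "blue (idx p - {d}) ((!) p) j" using iso.blue_iff[OF blue_in[OF i(1)]] by simp
      then show ?thesis using assms(2)[of j] i by simp
    qed (use assms(1) in simp)
  qed
  moreover have "card (insert d (bump d ` ?B)) = Suc (card (bump d ` ?B))"
    using fin by (intro card_insert_disjoint) auto
  moreover have "card (bump d ` ?B) = card ?B" by (rule card_image) (auto simp: inj_on_def)
  ultimately show ?thesis by (simp add: num_blue_eq)
qed

lemma removal:
  assumes L: "last_321 (idx p) ((!) p) x y" and rem: "d = (if x = Suc y then y else x)"
  shows "num_blue p = Suc (num_blue q)" "av (idx q) ((!) q)"
    "indec (idx p) ((!) p) \<Longrightarrow> indec (idx q) ((!) q)"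
proof -
  interpret L: last_321 "idx p" "(!) p" x y by (rule L)
  show "av (idx q) ((!) q)" using av_mono[OF L.av, of "idx p - {d}"] iso.av_iff by auto
  have "num_blue p = Suc (num_blue q) \<and> (indec (idx p) ((!) p) \<longrightarrow> indec (idx q) ((!) q))"
  proof (cases "x = Suc y")
    case True
    then have dy: "d = y" and adj: "\<forall>z\<in>idx p. \<not> (y < z \<and> z < x)" using rem by auto
    show ?thesis
      using num_blue_insertion[unfolded dy, OF L.delete_top(1,2)[OF adj]]
        L.delete_top(3)[OF adj] iso.indec_iff[unfolded dy] by simp
  next
    case False
    then have dx: "d = x" using rem by auto
    have w: "x - 1 \<in> idx p" "y < x - 1" "x - 1 < x" "\<forall>z\<in>idx p. \<not> (x - 1 < z \<and> z < x)"
      using False L.y_less_x L.x_in by auto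
    show ?thesis
      using num_blue_insertion[unfolded dx, OF L.delete_bottom(2,3)[OF w]]
        L.delete_bottom(4)[OF w] iso.indec_iff[unfolded dx] by simp
  qed
  then show "num_blue p = Suc (num_blue q)" "indec (idx p) ((!) p) \<Longrightarrow> indec (idx q) ((!) q)" by auto
qed

lemma new_site_iff:
  assumes d_n: "d < n"
  shows "new_site (idx p - {d}) ((!) p) d (Suc d) \<longleftrightarrow> (d, v) \<in> new_sites q"
proof -
  have S: "Suc d = bump d d" by (simp add: bump_def)
  have d_idx: "d \<in> idx q" using d_n len by simp
  \<comment> \<open>This turns a quantifier over the positions of \<open>p\<close> other than
    \<open>d\<close> into one over the positions of \<open>q\<close>.\<close>
  have all: "(\<forall>k. P k \<longrightarrow> Q k) \<longleftrightarrow> (\<forall>k. P' k \<longrightarrow> Q (bump d k))"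
    if "\<And>k. P k \<Longrightarrow> k \<in> idx p - {d}" "\<And>k. k \<in> idx q \<Longrightarrow> P (bump d k) \<longleftrightarrow> P' k" "\<And>k. P' k \<Longrightarrow> k \<in> idx q"
    for P P' Q
  proof (intro iffI allI impI)
    fix k assume "\<forall>k. P k \<longrightarrow> Q k" "P' k"
    then show "Q (bump d k)" using that(2,3) by simp
  next
    fix k assume h: "\<forall>k. P' k \<longrightarrow> Q (bump d k)" and k: "P k"
    have "k \<in> bump d ` idx q" using that(1)[OF k] iso.img by simp
    then obtain i where i: "i \<in> idx q" "k = bump d i" by blast
    then show "Q k" using h k that(2)[OF i(1)] by simp
  qed
  have 1: "(\<forall>k. one (idx p - {d}) ((!) p) k \<longrightarrow> k < Suc d) \<longleftrightarrow> (\<forall>k. one (idx q) ((!) q) k \<longrightarrow> k < d)"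
    using all[of "one (idx p - {d}) ((!) p)" "one (idx q) ((!) q)" "\<lambda>k. k < bump d d"]
      one_in[of "idx p - {d}"] one_in[of "idx q"] iso.one_iff unfolding S by simp
  have 2: "(\<forall>z. nonrec (idx p - {d}) ((!) p) z \<longrightarrow> p ! z < v \<longrightarrow> p ! z \<le> p ! Suc d) \<longleftrightarrow>
      (\<forall>z. nonrec (idx q) ((!) q) z \<longrightarrow> q ! z < v \<longrightarrow> q ! z \<le> q ! d)"
    unfolding S
  proof -
    have "(\<forall>k. nonrec (idx q) ((!) q) k \<longrightarrow> p ! bump d k < v \<longrightarrow> p ! bump d k \<le> p ! bump d d) \<longleftrightarrow>
      (\<forall>z. nonrec (idx q) ((!) q) z \<longrightarrow> q ! z < v \<longrightarrow> q ! z \<le> q ! d)"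
      using d_idx nth_bump len
      by (auto simp: nonrec_def bump_val_less linorder_not_less[symmetric])
    moreover have "(\<forall>z. nonrec (idx p - {d}) ((!) p) z \<longrightarrow> p ! z < v \<longrightarrow> p ! z \<le> p ! bump d d) \<longleftrightarrow>
      (\<forall>k. nonrec (idx q) ((!) q) k \<longrightarrow> p ! bump d k < v \<longrightarrow> p ! bump d k \<le> p ! bump d d)"
      by (rule all[of "nonrec (idx p - {d}) ((!) p)" "nonrec (idx q) ((!) q)"
          "\<lambda>z. p ! z < v \<longrightarrow> p ! z \<le> p ! bump d d"])
        (erule nonrec_in, erule iso.nonrec_iff, erule nonrec_in)
    ultimately show "(\<forall>z. nonrec (idx p - {d}) ((!) p) z \<longrightarrow> p ! z < v \<longrightarrow> p ! z \<le> p ! bump d d) \<longleftrightarrow>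
      (\<forall>z. nonrec (idx q) ((!) q) z \<longrightarrow> q ! z < v \<longrightarrow> q ! z \<le> q ! d)"
      by (rule trans[rotated])
  qed
  \<comment> \<open>The witness is the old maximum \<open>n\<close>, which is lifted to
    \<open>Suc n\<close> if the new value is at most \<open>n\<close>.\<close>
  have 3: "(\<exists>z\<in>idx p - {d}. v < p ! z) \<longleftrightarrow> v \<le> n"
  proof
    assume "\<exists>z\<in>idx p - {d}. v < p ! z"
    then obtain i where "i < n" "v < p ! bump d i" unfolding iso.img using len by auto
    then show "v \<le> n" using nth_bump[of i] val_bounds[of i] by (simp add: bump_val_greater)
  next
    assume vn: "v \<le> n"
    then have "n \<in> set q" using q v(1) by (simp add: perms_def)
    then obtain i where "i < n" "q ! i = n" using len by (auto simp: in_set_conv_nth)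
    then show "\<exists>z\<in>idx p - {d}. v < p ! z"
      unfolding iso.img using len vn nth_bump[of i] by (auto simp: bump_val_greater intro!: bexI[of _ i])
  qed
  have 4: "nonrec (idx p - {d}) ((!) p) (Suc d) \<longleftrightarrow> nonrec (idx q) ((!) q) d"
    using iso.nonrec_iff[OF d_idx] S by simp
  have 5: "p ! Suc d < v \<longleftrightarrow> q ! d < v"
    using nth_bump[OF d_n] S by (simp add: bump_val_less)
  show ?thesis unfolding new_site_def new_sites_def nth_d 1 2 3 4 5 using len by auto
qed

text \<open>All letters behind the cut are at least \<open>v\<close> and move up by one. The default
  value, used when nothing follows, grows with the length in the same way.\<close>

lemma min_after_insertion:
  assumes e: "d \<le> Suc e" "e < n" and large: "\<And>z. z < n \<Longrightarrow> e < z \<Longrightarrow> v \<le> q ! z"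
  shows "min_after p (Suc e) = Suc (min_after q e)"
proof (cases "Suc e < n")
  case True
  have "drop (Suc (Suc e)) p = map (bump v) (drop (Suc e) q)"
    using e d len by (simp add: p ins_def drop_map Suc_diff_le)
  also have "\<dots> = map Suc (drop (Suc e) q)"
    using large len by (intro map_cong) (auto simp: bump_def in_set_conv_nth less_diff_conv not_le[symmetric])
  finally have "set (drop (Suc (Suc e)) p) = Suc ` set (drop (Suc e) q)" by simp
  moreover have "Suc (Min (set (drop (Suc e) q))) = Min (Suc ` set (drop (Suc e) q))"
    using True len by (intro mono_Min_commute) (auto simp: mono_def)
  ultimately show ?thesis using True len by (simp add: min_after_def)
qed (use e len in \<open>simp add: min_after_def\<close>)

lemma insertion_class:
  assumes L: "last_321 (idx p) ((!) p) x y" and rem: "d = (if x = Suc y then y else x)"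
    and ind: "indec (idx p) ((!) p)"
  shows "p \<in> I_3241_4321_k (Suc n) (Suc (num_blue q))" "removable p = d"
    "label p = Suc n - min_after p x + (p ! y - p ! x)"
proof -
  show "p \<in> I_3241_4321_k (Suc n) (Suc (num_blue q))"
    using class_iff[OF p_perms] removal(1)[OF L rem] ind last_321.av[OF L] by simp
  show "removable p = d" using last_eq[OF L] rem by (simp add: removable_def)
  show "label p = Suc n - min_after p x + (p ! y - p ! x)"
    using last_eq[OF L] len by (simp add: label_def)
qed

text \<open>The last two is lifted to \<open>Suc (q ! y)\<close> and the new letter \<open>v\<close>
  becomes the last one. The other summand of the label is unchanged, as the length and the minimum
  both grow by one.\<close>

lemma insert_bottom_site:
  assumes L: "last_321 (idx q) ((!) q) x y" and ind: "indec (idx q) ((!) q)"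
    and site: "d = Suc x" "q ! x < v" "v \<le> q ! y"
  shows "p \<in> I_3241_4321_k (Suc n) (Suc (num_blue q))" "removable p = d"
    "label p = n - min_after q x + (Suc (q ! y) - v)"
proof -
  interpret L: last_321 "idx q" "(!) q" x y by (rule L)
  have xy: "x < n" "y < n" "y < x" using L.x_in L.y_in L.y_less_x len by auto
  have b: "bump d x = x" "bump d y = y" using site xy by (auto simp: bump_def)
  have px: "p ! x = q ! x" using nth_bump[of x] b site xy by (simp add: bump_def)
  have py: "p ! y = Suc (q ! y)" using nth_bump[of y] b site xy by (simp add: bump_def)
  have L0: "last_321 (idx p - {d}) ((!) p) x y" using iso.last_321_iff[of x y] L L.x_in L.y_in b by simp
  have "\<forall>z\<in>idx p. \<not> (x < z \<and> z < d)" using site by auto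
  note I = insert_bottom[OF L0 perms_inj[OF p_perms] d_in _ this]
  have L': "last_321 (idx p) ((!) p) d y" using I(1) site px py nth_d by simp
  have ind': "indec (idx p) ((!) p)" using I(2) site px py nth_d ind iso.indec_iff by simp
  have rem: "d = (if d = Suc y then y else d)" using site xy by simp
  note c = insertion_class[OF L' rem ind']
  show "p \<in> I_3241_4321_k (Suc n) (Suc (num_blue q))" "removable p = d" by (fact c)+
  have "min_after p (Suc x) = Suc (min_after q x)"
    using L.after_x len site xy by (intro min_after_insertion) fastforce+
  then show "label p = n - min_after q x + (Suc (q ! y) - v)"
    using c(3) site py nth_d by simp
qed

text \<open>The last one keeps its value while the last two is replaced by a letter one higher, so
  the label increases by exactly one.\<close>

lemma insert_top_site:
  assumes L: "last_321 (idx q) ((!) q) x y" and ind: "indec (idx q) ((!) q)"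
    and site: "d = x" "v = Suc (q ! y)"
  shows "p \<in> I_3241_4321_k (Suc n) (Suc (num_blue q))" "removable p = d"
    "label p = n - min_after q x + (Suc (q ! y) - q ! x)"
proof -
  interpret L: last_321 "idx q" "(!) q" x y by (rule L)
  have xy: "x < n" "y < n" "y < x" "q ! x < q ! y" using L.x_in L.y_in L.y_less_x L.fx_less_fy len by auto
  have b: "bump d x = Suc d" "bump d y = y" using site xy by (auto simp: bump_def)
  have px: "p ! Suc d = q ! x" using nth_bump[of x] b site xy by (simp add: bump_def)
  have py: "p ! y = q ! y" using nth_bump[of y] b site xy by (simp add: bump_def)
  have L0: "last_321 (idx p - {d}) ((!) p) (Suc d) y" using iso.last_321_iff[of x y] L L.x_in L.y_in b by simp
  have "\<forall>z\<in>idx p. \<not> (d < z \<and> z < Suc d)" by auto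
  note I = insert_top[OF L0 perms_inj[OF p_perms] d_in lessI this]
  have between: "\<forall>z\<in>idx p. \<not> (p ! y < p ! z \<and> p ! z < p ! d)" "p ! y < p ! d" using py nth_d site by auto
  have L': "last_321 (idx p) ((!) p) (Suc d) d" using I(1) between by simp
  have ind': "indec (idx p) ((!) p)" using I(2) between ind iso.indec_iff by simp
  have rem: "d = (if Suc d = Suc d then d else Suc d)" by simp
  note c = insertion_class[OF L' rem ind']
  show "p \<in> I_3241_4321_k (Suc n) (Suc (num_blue q))" "removable p = d" by (fact c)+
  have "min_after p (Suc x) = Suc (min_after q x)"
    using L.after_x len site xy by (intro min_after_insertion) fastforce+
  then show "label p = n - min_after q x + (Suc (q ! y) - q ! x)"
    using c(3) site px nth_d by simp
qed

text \<open>The new letter and the old letter at \<open>d\<close> become the last two and the last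
  one. The final claim serves to separate the labels belonging to different positions.\<close>

lemma insert_new_site:
  assumes av: "av (idx q) ((!) q)" and ind: "indec (idx q) ((!) q)" and site: "(d, v) \<in> new_sites q"
  shows "p \<in> I_3241_4321_k (Suc n) (Suc (num_blue q))" "removable p = d"
    "label p = n - min_after q d + (v - q ! d)"
    "\<And>z. z < n \<Longrightarrow> d < z \<Longrightarrow> v \<le> q ! z"
proof -
  have dn: "d < n" and dv: "q ! d < v" using site len by (auto simp: new_sites_def nonrec_def)
  have N: "new_site (idx p - {d}) ((!) p) d (Suc d)" using new_site_iff[OF dn] site by simp
  have av0: "av (idx p - {d}) ((!) p)" and ind0: "indec (idx p - {d}) ((!) p)"
    using av ind iso.av_iff iso.indec_iff by auto
  note I = insert_new[OF av0 ind0 perms_inj[OF p_perms] d_in N]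
  have rem: "d = (if Suc d = Suc d then d else Suc d)" by simp
  note c = insertion_class[OF I(1) rem I(2)]
  show "p \<in> I_3241_4321_k (Suc n) (Suc (num_blue q))" "removable p = d" by (fact c)+
  have inj: "inj_on ((!) p) (insert d (idx p - {d}))"
    using perms_inj[OF p_perms] d_in by (simp add: insert_absorb)
  show large: "v \<le> q ! z" if z: "z < n" "d < z" for z
  proof -
    have "bump d z = Suc z" using z by (simp add: bump_def)
    then have "p ! d < p ! bump d z"
      using new_site_facts(2)[OF av0 ind0 inj _ N, of "bump d z"] z iso.g_in[of z] len by simp
    then show ?thesis using nth_bump[OF z(1)] nth_d by (simp add: bump_val_greater)
  qed
  have "p ! Suc d = q ! d" using nth_bump[OF dn] dv by (simp add: bump_def)
  moreover have "min_after p (Suc d) = Suc (min_after q d)"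
    using large dn by (intro min_after_insertion) auto
  ultimately show "label p = n - min_after q d + (v - q ! d)" using c(3) nth_d by simp
qed

end

text \<open>The first three letters of a 4312 form a 321, so a blue letter of either kind requires a
  321.\<close>

lemma num_blue_eq_0: "num_blue p = 0 \<longleftrightarrow> \<not> contains p [3, 2, 1]"
proof -
  have "finite {j. blue (idx p) ((!) p) j}" by (rule finite_subset[of _ "idx p"]) (auto dest: blue_in)
  then have "num_blue p = 0 \<longleftrightarrow> (\<forall>j. \<not> blue (idx p) ((!) p) j)"
    by (simp add: num_blue_eq)
  also have "\<dots> \<longleftrightarrow> (\<forall>i j k. \<not> tri (idx p) ((!) p) i j k)"
    unfolding blue_def two_def tri_def by (meson less_trans)
  finally show ?thesis unfolding contains_321 one_def by blast
qed

lemma insert_site: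
  assumes q: "q \<in> I_3241_4321_k n k" and s: "(d, v) \<in> sites q"
  shows "d \<le> n" "1 \<le> v" "v \<le> Suc n" "ins q d v \<in> I_3241_4321_k (Suc n) (Suc k)" "removable (ins q d v) = d"
proof -
  have qp: "q \<in> perms n" using q by (simp add: I_3241_4321_k_def I_3241_4321_def)
  have c: "av (idx q) ((!) q)" "indec (idx q) ((!) q)" "num_blue q = k" using class_iff[OF qp] q by auto
  have len: "length q = n" using qp by (simp add: perms_def)
  have val: "q ! i \<in> {1..n}" if "i < n" for i using qp that nth_mem[of i q] by (auto simp: perms_def)
  have L: "last_321 (idx q) ((!) q) (last1 q) (last2 q)" if "contains q [3, 2, 1]"
    using last_321_exists[OF c(1) perms_inj[OF qp] that] .
  have lt: "last1 q < n" "last2 q < n" if "contains q [3, 2, 1]"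
    using last_321.x_in[OF L[OF that]] last_321.y_in[OF L[OF that]] len by auto
  consider (new) "(d, v) \<in> new_sites q"
    | (bottom) "contains q [3, 2, 1]" "d = Suc (last1 q)" "q ! last1 q < v" "v \<le> q ! last2 q"
    | (top) "contains q [3, 2, 1]" "d = last1 q" "v = Suc (q ! last2 q)"
    using s by (auto simp: sites_def bottom_sites_def split: if_splits)
  note cases = this
  show b: "d \<le> n" "1 \<le> v" "v \<le> Suc n"
    using cases lt val[of "last2 q"] len
    by (cases; auto simp: new_sites_def nonrec_def)+
  interpret insertion q "ins q d v" n d v using qp b by unfold_locales auto
  show "ins q d v \<in> I_3241_4321_k (Suc n) (Suc k)" "removable (ins q d v) = d"
    using cases
    by (cases; use insert_new_site(1,2)[OF c(1,2)] insert_bottom_site(1,2)[OF L c(2)]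
          insert_top_site(1,2)[OF L c(2)] c(3) in auto)+
qed

text \<open>If \<open>x\<close> directly follows \<open>y\<close>, then
  \<open>delete_top_site\<close> yields a top site or a new site. Otherwise the letter before
  \<open>x\<close> is the last one of the smaller permutation, and \<open>x\<close> came from a
  bottom site.\<close>

lemma removal_site:
  assumes p: "p \<in> I_3241_4321_k (Suc n) (Suc k)" and d: "d = removable p"
  shows "d \<le> n" "del p d \<in> I_3241_4321_k n k" "(d, p ! d) \<in> sites (del p d)"
proof -
  have pp: "p \<in> perms (Suc n)" using p by (simp add: I_3241_4321_k_def I_3241_4321_def)
  have c: "av (idx p) ((!) p)" "indec (idx p) ((!) p)" "num_blue p = Suc k" using class_iff[OF pp] p by auto
  have len: "length p = Suc n" "distinct p" "set p = {1..Suc n}" using pp by (auto simp: perms_def)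
  have "contains p [3, 2, 1]" using c(3) num_blue_eq_0[of p] by simp
  note L = last_321_exists[OF c(1) perms_inj[OF pp] this]
  define x y where "x = last1 p" and "y = last2 p"
  interpret L: last_321 "idx p" "(!) p" x y unfolding x_def y_def by (rule L)
  have rem: "d = (if x = Suc y then y else x)" by (simp add: d removable_def x_def y_def)
  have xy: "x \<le> n" "y < x" using L.x_in L.y_less_x len by auto
  then show dn: "d \<le> n" using rem by auto
  have "p ! d \<in> set p" using dn len(1) by (intro nth_mem) simp
  then have v: "1 \<le> p ! d" "p ! d \<le> Suc n" using len(3) by auto
  interpret I: insertion "del p d" p n d "p ! d"
    using del_perms[OF pp dn] dn v ins_del[of p d] len by unfold_locales auto
  note R = I.removal[OF L.last_321_axioms rem]
  have n1: "n \<ge> 1" using xy by simp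
  show "del p d \<in> I_3241_4321_k n k" using class_iff[OF I.q, of k] R c n1 by simp
  let ?q = "del p d"
  show "(d, p ! d) \<in> sites ?q"
  proof (cases "x = Suc y")
    case True
    then have dy: "d = y" "x = Suc d" and adj: "\<forall>z\<in>idx p. \<not> (y < z \<and> z < x)" using rem by auto
    have bx: "bump d d = x" using dy by (simp add: bump_def)
    have dq: "d < n" "d \<in> idx ?q" using dy xy dn len(1) I.len(1) by auto
    from L.delete_top_site[OF adj] show ?thesis
    proof
      assume "new_site (idx p - {y}) ((!) p) y x"
      then show ?thesis using I.new_site_iff[OF dq(1)] dy by (simp add: sites_def)
    next
      assume "\<exists>b. last_321 (idx p - {y}) ((!) p) x b \<and> p ! b < p ! y \<and> (\<forall>z\<in>idx p. \<not> (p ! b < p ! z \<and> p ! z < p ! y))"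
      then obtain b where b: "last_321 (idx p - {d}) ((!) p) x b" "p ! b < p ! d"
        "\<forall>z\<in>idx p. \<not> (p ! b < p ! z \<and> p ! z < p ! d)" using dy by auto
      have "b \<in> bump d ` idx ?q" using last_321.y_in[OF b(1)] I.iso.img by simp
      then obtain b0 where b0: "b0 \<in> idx ?q" "b = bump d b0" by blast
      have L0: "last_321 (idx ?q) ((!) ?q) d b0" using I.iso.last_321_iff[OF dq(2) b0(1)] b(1) b0(2) bx by simp
      have b0n: "b0 < n" using b0 I.len(1) by simp
      have less: "?q ! b0 < p ! d" using b(2) I.nth_bump[OF b0n] b0(2) by (simp add: bump_val_less)
      have pb: "p ! b = ?q ! b0" using less I.nth_bump[OF b0n] b0(2) by (simp add: bump_def)
      \<comment> \<open>All values of the range occur in \<open>p\<close>, so two values with no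
        letter between them are consecutive.\<close>
      have "p ! d = Suc (?q ! b0)"
      proof (rule ccontr)
        assume "p ! d \<noteq> Suc (?q ! b0)"
        then have lt: "Suc (?q ! b0) < p ! d" using less by simp
        then have "Suc (?q ! b0) \<in> set p" using len(3) v by auto
        then obtain i where "i < length p" "p ! i = Suc (?q ! b0)" by (auto simp: in_set_conv_nth)
        then show False using b(3)[rule_format, of i] lt pb by simp
      qed
      then show ?thesis using last_eq[OF L0] by (simp add: sites_def)
    qed
  next
    case False
    then have dx: "d = x" using rem by auto
    have w: "x - 1 \<in> idx p" "y < x - 1" "x - 1 < x" "\<forall>z\<in>idx p. \<not> (x - 1 < z \<and> z < x)"
      using False xy len(1) by auto
    have b: "bump d (x - 1) = x - 1" "bump d y = y" using dx w by (auto simp: bump_def)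
    have i: "x - 1 < n" "y < n" using xy by auto
    have L0: "last_321 (idx ?q) ((!) ?q) (x - 1) y"
      using I.iso.last_321_iff[of "x - 1" y] L.delete_bottom(1)[OF w] b i I.len(1) dx by simp
    have "p ! (x - 1) < p ! d" using L.between[OF w(1-3)] dx by simp
    then have "?q ! (x - 1) < p ! d" using I.nth_bump[OF i(1)] b by (simp add: bump_val_less)
    moreover have "p ! d \<le> ?q ! y" using L.fx_less_fy I.nth_bump[OF i(2)] b dx by (simp add: bump_val_greater)
    ultimately have "(d, p ! d) \<in> bottom_sites ?q"
      using last_eq[OF L0] dx w by (simp add: bottom_sites_def)
    then show ?thesis using last_eq[OF L0] by (simp add: sites_def)
  qed
qed

section \<open>Counting the insertion sites\<close>

text \<open>This is the bound that the value of a new site has to exceed. In the 321-free case the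
  letter 1 takes the role of the smallest letter after the last one.\<close>

definition floor_value :: "nat list \<Rightarrow> nat" where
  "floor_value q = (if contains q [3, 2, 1] then min_after q (last1 q) else 1)"

lemma min_after_le: "e < z \<Longrightarrow> z < length q \<Longrightarrow> min_after q e \<le> q ! z"
  unfolding min_after_def
  by (auto simp: in_set_conv_nth intro!: Min_le exI[of _ "z - Suc e"])

lemma min_after_in:
  assumes "Suc e < length q"
  obtains z where "e < z" "z < length q" "q ! z = min_after q e"
proof -
  have "Min (set (drop (Suc e) q)) \<in> set (drop (Suc e) q)" using assms by (intro Min_in) auto
  then obtain i where "i < length q - Suc e" "q ! (Suc e + i) = Min (set (drop (Suc e) q))"
    by (auto simp: in_set_conv_nth)
  then show ?thesis using that[of "Suc e + i"] assms by (simp add: min_after_def)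
qed

text \<open>By indecomposability the letter \<open>a\<close> with value \<open>floor_value q\<close>
  is a non-record, and it stands after all ones. So there are non-records below \<open>v\<close>,
  and \<open>e\<close> is the largest of them.\<close>

lemma new_site_exists:
  assumes q: "q \<in> I_3241_4321_k n k" and n: "n \<ge> 2" and v: "floor_value q < v" "v \<le> n"
  shows "\<exists>e. (e, v) \<in> new_sites q"
proof -
  have qp: "q \<in> perms n" using q by (simp add: I_3241_4321_k_def I_3241_4321_def)
  have c: "av (idx q) ((!) q)" "indec (idx q) ((!) q)" using class_iff[OF qp] q by auto
  have len: "length q = n" "set q = {1..n}" using qp by (auto simp: perms_def)
  have inj: "i = j" if "i < n" "j < n" "q ! i = q ! j" for i j
    using perms_inj[OF qp] that len by (auto simp: inj_on_def)
  have "\<exists>a. nonrec (idx q) ((!) q) a \<and> q ! a = floor_value q \<and> (\<forall>k. one (idx q) ((!) q) k \<longrightarrow> k < a)"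
  proof (cases "contains q [3, 2, 1]")
    case True
    interpret L: last_321 "idx q" "(!) q" "last1 q" "last2 q"
      using last_321_exists[OF c(1) perms_inj[OF qp] True] .
    define x where "x = last1 q"
    have fl: "floor_value q = min_after q x" using True by (simp add: floor_value_def x_def)
    have "Suc x < n" using v fl len by (auto simp: min_after_def split: if_splits)
    then obtain a where a: "x < a" "a < n" "q ! a = min_after q x"
      using min_after_in[of x q] len by auto
    obtain i j where ij: "i < n" "j < n" "i < Suc x" "Suc x \<le> j" "q ! j < q ! i"
      using indec_cut[OF c(2), of x "Suc x" a] a len by auto
    have "q ! a \<le> q ! j" using min_after_le[of x j q] a ij len by simp
    then have "nonrec (idx q) ((!) q) a"
      unfolding nonrec_def using ij a len by (auto intro!: bexI[of _ i])
    moreover have "k < a" if "one (idx q) ((!) q) k" for k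
      using L.X that a unfolding last_one_def x_def by fastforce
    ultimately show ?thesis using a fl by auto
  next
    case False
    have "1 \<in> set q" using len n by simp
    then obtain a where a: "a < n" "q ! a = 1" using len(1) by (auto simp: in_set_conv_nth)
    obtain i j where ij: "i < n" "j < n" "i < 1" "1 \<le> j" "q ! j < q ! i"
      by (rule indec_cut[OF c(2), of 0 1 "n - 1"]) (use n len(1) in auto)
    have "q ! j \<in> {1..n}" using ij len nth_mem by blast
    then have "q ! 0 > 1" using ij by auto
    then have "a \<noteq> 0" "q ! a < q ! 0" using a by (metis less_irrefl, simp)
    then have "nonrec (idx q) ((!) q) a"
      unfolding nonrec_def using a len by (auto intro!: bexI[of _ 0])
    then show ?thesis using a False contains_321 by (auto simp: floor_value_def)
  qed
  then obtain a where a: "nonrec (idx q) ((!) q) a" "q ! a = floor_value q"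
    "\<And>k. one (idx q) ((!) q) k \<Longrightarrow> k < a" by blast
  define A where "A = {z. nonrec (idx q) ((!) q) z \<and> q ! z < v}"
  have fin: "finite A" by (rule finite_subset[of _ "idx q"]) (auto simp: A_def nonrec_def)
  have aA: "a \<in> A" using a v by (simp add: A_def)
  obtain e where e: "e \<in> A" "\<And>z. z \<in> A \<Longrightarrow> q ! z \<le> q ! e"
  proof -
    have "Max ((!) q ` A) \<in> (!) q ` A" using fin aA by (intro Max_in) auto
    then obtain e where "e \<in> A" "q ! e = Max ((!) q ` A)" by auto
    then show ?thesis using that[of e] fin by simp
  qed
  \<comment> \<open>Otherwise \<open>e\<close> would be a non-record standing before the smaller
    letter \<open>a\<close>, which would make \<open>a\<close> a one.\<close>
  have "k < e" if k: "one (idx q) ((!) q) k" for k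
  proof (rule ccontr)
    assume "\<not> k < e"
    then have ea: "e < a" using a(3)[OF k] by simp
    have "q ! a \<noteq> q ! e" using ea e(1) a(1) inj[of a e] len by (auto simp: A_def nonrec_def)
    then have ae: "q ! a < q ! e" using e(2)[OF aA] by simp
    obtain c where "c \<in> idx q" "c < e" "q ! e < q ! c" "e \<in> idx q" using e(1) by (auto simp: A_def nonrec_def)
    then have "tri (idx q) ((!) q) c e a" using ea ae a(1) by (auto simp: tri_def nonrec_def)
    then show False using a(3)[of a] unfolding one_def by blast
  qed
  then have "(e, v) \<in> new_sites q" using e v len by (auto simp: new_sites_def A_def)
  then show ?thesis by blast
qed

text \<open>Each value above the floor and at most \<open>n\<close> belongs to exactly one site,
  which gives the number of sites. The labels lie in an interval of the same size, so injectivity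
  suffices.\<close>

lemma label_new_sites:
  assumes q: "q \<in> I_3241_4321_k n k" and n: "n \<ge> 2"
  shows "bij_betw (\<lambda>(d, v). label (ins q d v)) (new_sites q) {1..n - floor_value q}"
proof -
  have qp: "q \<in> perms n" using q by (simp add: I_3241_4321_k_def I_3241_4321_def)
  have c: "av (idx q) ((!) q)" "indec (idx q) ((!) q)" using class_iff[OF qp] q by auto
  have len: "length q = n" "set q = {1..n}" using qp by (auto simp: perms_def)
  have val: "1 \<le> q ! i" "q ! i \<le> n" if "i < n" for i using that len nth_mem[of i q] by auto
  have inj: "i = j" if "i < n" "j < n" "q ! i = q ! j" for i j
    using perms_inj[OF qp] that len by (auto simp: inj_on_def)
  have site: "e < n" "floor_value q \<le> q ! e" "q ! e < v" "v \<le> n" "v \<le> min_after q e" "min_after q e \<le> n"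
    "label (ins q e v) = n - min_after q e + (v - q ! e)"
    if s: "(e, v) \<in> new_sites q" for e v
  proof -
    show e: "e < n" "q ! e < v" "v \<le> n" using s len by (auto simp: new_sites_def nonrec_def)
    interpret insertion q "ins q e v" n e v using qp e by unfold_locales auto
    note I = insert_new_site[OF c s]
    show "label (ins q e v) = n - min_after q e + (v - q ! e)" by (fact I(3))
    show "v \<le> min_after q e"
    proof (cases "Suc e < n")
      case True
      then obtain z where "e < z" "z < n" "q ! z = min_after q e" using min_after_in[of e q] len by auto
      then show ?thesis using I(4)[of z] by simp
    qed (use e len in \<open>simp add: min_after_def\<close>)
    show "min_after q e \<le> n"
    proof (cases "Suc e < n")
      case True
      then obtain z where "e < z" "z < n" "q ! z = min_after q e" using min_after_in[of e q] len by auto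
      then show ?thesis using val[of z] by simp
    qed (use len in \<open>simp add: min_after_def\<close>)
    show "floor_value q \<le> q ! e"
    proof (cases "contains q [3, 2, 1]")
      case True
      interpret L: last_321 "idx q" "(!) q" "last1 q" "last2 q"
        using last_321_exists[OF c(1) perms_inj[OF qp] True] .
      have "last1 q < e" using s L.X by (auto simp: new_sites_def last_one_def)
      then show ?thesis using min_after_le[of "last1 q" e q] e len True by (simp add: floor_value_def)
    qed (use e val in \<open>simp add: floor_value_def\<close>)
  qed
  let ?l = "\<lambda>(d, v). label (ins q d v)"
  \<comment> \<open>The value \<open>v'\<close> is at most \<open>min_after q e'\<close>, so the
    label of \<open>(e', v')\<close> is at most \<open>n - q ! e'\<close>. This is at most
    \<open>n - min_after q e\<close>, which is less than the label of \<open>(e, v)\<close>.\<close>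
  have order: "label (ins q e' v') < label (ins q e v)"
    if s: "(e, v) \<in> new_sites q" "(e', v') \<in> new_sites q" and less: "q ! e < q ! e'" for e v e' v'
  proof -
    have "e < e'"
    proof (rule ccontr)
      assume "\<not> e < e'"
      then have "e' < e" using less by (metis less_irrefl linorder_neqE_nat)
      moreover obtain c where "c \<in> idx q" "c < e'" "q ! e' < q ! c"
        using s(2) by (auto simp: new_sites_def nonrec_def)
      ultimately have "tri (idx q) ((!) q) c e' e" using less site(1)[OF s(1)] site(1)[OF s(2)] len
        by (auto simp: tri_def)
      then have "one (idx q) ((!) q) e" unfolding one_def by blast
      then show False using s(1) by (auto simp: new_sites_def)
    qed
    then have "min_after q e \<le> q ! e'" using min_after_le site(1)[OF s(2)] len by simp
    then show ?thesis using site[OF s(1)] site[OF s(2)] by simp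
  qed
  have inj_l: "inj_on ?l (new_sites q)"
  proof (rule inj_onI, clarify)
    fix e v e' v' assume s: "(e, v) \<in> new_sites q" "(e', v') \<in> new_sites q"
      and eq: "label (ins q e v) = label (ins q e' v')"
    have "q ! e = q ! e'" using order[OF s] order[OF s(2,1)] eq by (metis less_irrefl linorder_neqE_nat)
    then have "e = e'" using inj site(1)[OF s(1)] site(1)[OF s(2)] by blast
    then show "e = e' \<and> v = v'" using eq site[OF s(1)] site[OF s(2)] by simp
  qed
  have "bij_betw snd (new_sites q) {floor_value q<..n}"
    unfolding bij_betw_def
  proof
    show "inj_on snd (new_sites q)"
    proof (rule inj_onI, clarify)
      fix e v e' v' assume s: "(e, v) \<in> new_sites q" "(e', v') \<in> new_sites q" and "snd (e, v) = snd (e', v')"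
      \<comment> \<open>Both are the largest non-record value below the common
        \<open>v\<close>.\<close>
      then have "q ! e = q ! e'" by (auto simp: new_sites_def intro!: antisym)
      then show "e = e' \<and> v = v'"
        using inj site(1)[OF s(1)] site(1)[OF s(2)] \<open>snd (e, v) = snd (e', v')\<close> by simp
    qed
    show "snd ` new_sites q = {floor_value q<..n}"
    proof (intro set_eqI iffI)
      fix v assume "v \<in> snd ` new_sites q"
      then obtain e where "(e, v) \<in> new_sites q" by auto
      then show "v \<in> {floor_value q<..n}" using site[of e v] by auto
    next
      fix v assume "v \<in> {floor_value q<..n}"
      then obtain e where "(e, v) \<in> new_sites q" using new_site_exists[OF q n] by auto
      then show "v \<in> snd ` new_sites q" by force
    qed
  qed
  then have "card (new_sites q) = n - floor_value q" by (simp add: bij_betw_same_card)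
  then have "card (?l ` new_sites q) = card {1..n - floor_value q}" using card_image[OF inj_l] by simp
  moreover have "?l ` new_sites q \<subseteq> {1..n - floor_value q}"
  proof clarify
    fix e v assume "(e, v) \<in> new_sites q"
    from site[OF this] show "label (ins q e v) \<in> {1..n - floor_value q}"
      unfolding atLeastAtMost_iff by linarith
  qed
  ultimately show ?thesis using inj_l by (simp add: bij_betw_def card_subset_eq)
qed

text \<open>If 321 occurs, new sites supply the labels up to \<open>G\<close>, bottom sites those
  from \<open>Suc G\<close> to \<open>label q\<close>, and the top site supplies the last one. In
  the 321-free case there are only new sites, and \<open>n - 1\<close> equals
  \<open>Suc (n - 2)\<close> because \<open>n\<close> is at least 2.\<close>

lemma label_sites:
  assumes q: "q \<in> I_3241_4321_k n k" and n: "n \<ge> 2"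
  shows "bij_betw (\<lambda>(d, v). label (ins q d v)) (sites q) {1..Suc (label q)}"
proof (cases "contains q [3, 2, 1]")
  case False
  have "length q = n" using q by (simp add: I_3241_4321_k_def I_3241_4321_def perms_def)
  then have "n - floor_value q = Suc (label q)" using False n by (simp add: floor_value_def label_def)
  then show ?thesis using label_new_sites[OF q n] False by (simp add: sites_def)
next
  case True
  have qp: "q \<in> perms n" using q by (simp add: I_3241_4321_k_def I_3241_4321_def)
  have c: "av (idx q) ((!) q)" "indec (idx q) ((!) q)" using class_iff[OF qp] q by auto
  have len: "length q = n" "set q = {1..n}" using qp by (auto simp: perms_def)
  define x y where "x = last1 q" and "y = last2 q"
  have L: "last_321 (idx q) ((!) q) x y"
    unfolding x_def y_def using last_321_exists[OF c(1) perms_inj[OF qp] True] .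
  interpret L: last_321 "idx q" "(!) q" x y by (rule L)
  have xy: "x < n" "y < n" "q ! x < q ! y" using L.x_in L.y_in L.fx_less_fy len by auto
  have yn: "q ! y \<le> n" using xy len nth_mem[of y q] by auto
  let ?l = "\<lambda>(d, v). label (ins q d v)"
  define G where "G = n - floor_value q"
  have G: "G = n - min_after q x" using True by (simp add: G_def floor_value_def x_def)
  have lab: "label q = G + (q ! y - q ! x)" using True G len by (simp add: label_def x_def y_def)
  have bottom: "label (ins q (Suc x) v) = G + (Suc (q ! y) - v)" if "q ! x < v" "v \<le> q ! y" for v
  proof -
    interpret insertion q "ins q (Suc x) v" n "Suc x" v using qp xy yn that by unfold_locales auto
    show ?thesis using insert_bottom_site(3)[OF L c(2)] that G by simp
  qed
  have top: "label (ins q x (Suc (q ! y))) = Suc (label q)"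
  proof -
    interpret insertion q "ins q x (Suc (q ! y))" n x "Suc (q ! y)" using qp xy yn by unfold_locales auto
    show ?thesis using insert_top_site(3)[OF L c(2)] lab G xy by simp
  qed
  have "bij_betw ?l (bottom_sites q) {Suc G..label q}"
  \<comment> \<open>Among bottom sites the label falls by one whenever the value rises by one, hence
    the reflection as inverse.\<close>
  proof (rule bij_betw_byWitness[where f' = "\<lambda>i. (Suc x, Suc (q ! y) + G - i)"])
    show "?l ` bottom_sites q \<subseteq> {Suc G..label q}"
      using bottom lab by (auto simp: bottom_sites_def x_def[symmetric] y_def[symmetric])
    show "(\<lambda>i. (Suc x, Suc (q ! y) + G - i)) ` {Suc G..label q} \<subseteq> bottom_sites q"
      using lab xy by (auto simp: bottom_sites_def x_def[symmetric] y_def[symmetric] image_iff)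
    show "\<forall>s\<in>bottom_sites q. (Suc x, Suc (q ! y) + G - ?l s) = s"
      using bottom by (auto simp: bottom_sites_def x_def[symmetric] y_def[symmetric])
    show "\<forall>i\<in>{Suc G..label q}. ?l (Suc x, Suc (q ! y) + G - i) = i"
    proof
      fix i assume "i \<in> {Suc G..label q}"
      then show "?l (Suc x, Suc (q ! y) + G - i) = i"
        using bottom[of "Suc (q ! y) + G - i"] lab xy by auto
    qed
  qed
  moreover have "bij_betw ?l {(x, Suc (q ! y))} {Suc (label q)}" using top by (simp add: bij_betw_def)
  moreover have "bij_betw ?l (new_sites q) {1..G}" using label_new_sites[OF q n] by (simp add: G_def)
  ultimately have "bij_betw ?l (new_sites q \<union> (bottom_sites q \<union> {(x, Suc (q ! y))}))
      ({1..G} \<union> ({Suc G..label q} \<union> {Suc (label q)}))"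
    using lab by (intro bij_betw_combine) auto
  moreover have "{1..G} \<union> ({Suc G..label q} \<union> {Suc (label q)}) = {1..Suc (label q)}" using lab by auto
  ultimately show ?thesis using True by (simp add: sites_def x_def y_def)
qed

section \<open>The recursion and the resulting bijection\<close>

lemma removal_bij:
  assumes n: "n \<ge> 2"
  shows "bij_betw (\<lambda>p. (del p (removable p), label p)) (I_3241_4321_k (Suc n) (Suc k))
    (SIGMA q : I_3241_4321_k n k. {1..Suc (label q)})"
  unfolding bij_betw_def
proof
  have rec: "ins (del p (removable p)) (removable p) (p ! removable p) = p"
    if "p \<in> I_3241_4321_k (Suc n) (Suc k)" for p
    using ins_del[of p "removable p"] removal_site(1)[OF that refl] that
    by (simp add: I_3241_4321_k_def I_3241_4321_def perms_def)
  show "inj_on (\<lambda>p. (del p (removable p), label p)) (I_3241_4321_k (Suc n) (Suc k))"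
  proof (rule inj_onI, clarify)
    fix p p' assume p: "p \<in> I_3241_4321_k (Suc n) (Suc k)" "p' \<in> I_3241_4321_k (Suc n) (Suc k)"
      and eq: "del p (removable p) = del p' (removable p')" "label p = label p'"
    define q where "q = del p (removable p)"
    have s: "(removable p, p ! removable p) \<in> sites q" "(removable p', p' ! removable p') \<in> sites q"
      using removal_site(3)[OF p(1) refl] removal_site(3)[OF p(2) refl] eq by (auto simp: q_def)
    have "q \<in> I_3241_4321_k n k" using removal_site(2)[OF p(1) refl] by (simp add: q_def)
    \<comment> \<open>Both permutations arise from the same \<open>q\<close>, where the label
      determines the site.\<close>
    then have "inj_on (\<lambda>(d, v). label (ins q d v)) (sites q)" using label_sites[OF _ n] bij_betw_def by blast
    from inj_onD[OF this _ s] have "(removable p, p ! removable p) = (removable p', p' ! removable p')"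
      using rec[OF p(1)] rec[OF p(2)] eq by (simp add: q_def)
    then show "p = p'" using rec[OF p(1)] rec[OF p(2)] eq(1) by (metis Pair_inject)
  qed
  show "(\<lambda>p. (del p (removable p), label p)) ` I_3241_4321_k (Suc n) (Suc k) =
    (SIGMA q : I_3241_4321_k n k. {1..Suc (label q)})"
  proof (intro equalityI subsetI)
    fix r assume "r \<in> (\<lambda>p. (del p (removable p), label p)) ` I_3241_4321_k (Suc n) (Suc k)"
    then obtain p where p: "p \<in> I_3241_4321_k (Suc n) (Suc k)" "r = (del p (removable p), label p)" by blast
    note R = removal_site(2,3)[OF p(1) refl]
    have "label p \<in> {1..Suc (label (del p (removable p)))}"
      using bij_betw_apply[OF label_sites[OF R(1) n] R(2)] rec[OF p(1)] by simp
    then show "r \<in> (SIGMA q : I_3241_4321_k n k. {1..Suc (label q)})" using R p by simp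
  next
    fix r assume "r \<in> (SIGMA q : I_3241_4321_k n k. {1..Suc (label q)})"
    then obtain q i where r: "r = (q, i)" and q: "q \<in> I_3241_4321_k n k" and i: "i \<in> {1..Suc (label q)}" by blast
    obtain d v where s: "(d, v) \<in> sites q" "i = label (ins q d v)"
      using bij_betw_imp_surj_on[OF label_sites[OF q n]] i by fastforce
    note I = insert_site[OF q s(1)]
    have "d \<le> length q" using I(1) q by (simp add: I_3241_4321_k_def I_3241_4321_def perms_def)
    then have "r = (del (ins q d v) (removable (ins q d v)), label (ins q d v))"
      using del_ins I(5) s(2) r by simp
    then show "r \<in> (\<lambda>p. (del p (removable p), label p)) ` I_3241_4321_k (Suc n) (Suc k)" using I(4) by blast
  qed
qed

text \<open>The entry \<open>a\<^sub>k\<close> of a sequence of length \<open>k\<close>, with the convention \<open>a\<^sub>0 = r\<close>.\<close>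

definition C_end :: "nat \<Rightarrow> int list \<Rightarrow> int" where
  "C_end r a = (if a = [] then int r else last a)"

text \<open>Reading the empty sequence as ending in \<open>r\<close> merges the bound on the first
  entry with the bound on later entries.\<close>

lemma C_seq_snoc: "a @ [b] \<in> C_seq (Suc k) r \<longleftrightarrow> a \<in> C_seq k r \<and> 1 \<le> b \<and> b \<le> C_end r a + 1"
proof (cases "length a = k")
  case True
  have nth: "(a @ [b]) ! i = (if i < k then a ! i else b)" if "i < Suc k" for i
    using that True by (auto simp: nth_append less_Suc_eq)
  show ?thesis
  proof (cases k)
    case 0
    then show ?thesis using True by (auto simp: C_seq_def C_end_def)
  next
    case (Suc m)
    have "last a = a ! m" using True Suc by (subst last_conv_nth) auto
    then have e: "C_end r a = a ! m" using True Suc by (auto simp: C_end_def)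
    show ?thesis unfolding C_seq_def e using True Suc nth
      by (auto simp: nth_append less_Suc_eq all_conj_distrib)
  qed
qed (auto simp: C_seq_def)

theorem theorem3:
  fixes n k :: nat
  assumes "n \<ge> 2" and "k \<le> n - 2"
  shows "\<exists>f. bij_betw f (I_3241_4321_k n k) (I_321 (n - k) \<times> C_seq k (n - k - 2))"
proof -
  \<comment> \<open>The difference \<open>m\<close> of size and number of blue letters stays fixed.
    The induction also records that the label is the end of the sequence, because this number
    governs the possible continuations on both sides.\<close>
  have "\<exists>f. bij_betw f (I_3241_4321_k (m + k) k) (I_321 m \<times> C_seq k (m - 2)) \<and>
      (\<forall>p\<in>I_3241_4321_k (m + k) k. C_end (m - 2) (snd (f p)) = int (label p))" if m: "m \<ge> 2" for m
  proof (induction k)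
    case 0
    have no: "\<not> contains p [3, 2, 1]" if "p \<in> I_3241_4321_k m 0" for p
      using that num_blue_eq_0 by (simp add: I_3241_4321_k_def)
    have "I_3241_4321_k m 0 = I_321 m"
    proof (intro set_eqI iffI)
      fix p assume "p \<in> I_3241_4321_k m 0"
      then show "p \<in> I_321 m" using no by (auto simp: I_3241_4321_k_def I_3241_4321_def I_321_def avoids_def)
    next
      fix p assume p: "p \<in> I_321 m"
      then have "\<not> contains p [3, 2, 1]" by (simp add: I_321_def avoids_def)
      moreover from this have "av (idx p) ((!) p)"
        unfolding contains_321 one_def by (intro avI) blast+
      ultimately show "p \<in> I_3241_4321_k m 0"
        using p num_blue_eq_0 av_iff_avoids by (auto simp: I_3241_4321_k_def I_3241_4321_def I_321_def)
    qed
    moreover have "C_seq 0 (m - 2) = {[]}" by (auto simp: C_seq_def)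
    ultimately have "bij_betw (\<lambda>p. (p, [])) (I_3241_4321_k m 0) (I_321 m \<times> C_seq 0 (m - 2))"
      by (auto simp: bij_betw_def inj_on_def)
    moreover have "C_end (m - 2) [] = int (label p)" if "p \<in> I_3241_4321_k m 0" for p
      using no[OF that] that m
      by (simp add: C_end_def label_def I_3241_4321_k_def I_3241_4321_def perms_def)
    ultimately show ?case by (intro exI[of _ "\<lambda>p. (p, [])"]) simp
  next
    case (Suc k)
    let ?A = "I_3241_4321_k (m + k) k" and ?B = "I_3241_4321_k (Suc (m + k)) (Suc k)"
    obtain f where f: "bij_betw f ?A (I_321 m \<times> C_seq k (m - 2))"
      and e: "\<And>p. p \<in> ?A \<Longrightarrow> C_end (m - 2) (snd (f p)) = int (label p)" using Suc.IH by blast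
    \<comment> \<open>The image of a permutation is that of its parent, with its own label appended
      to the sequence.\<close>
    define g where "g = (\<lambda>(q, i). (fst (f q), snd (f q) @ [int i]))"
    have "bij_betw g (SIGMA q : ?A. {1..Suc (label q)}) (I_321 m \<times> C_seq (Suc k) (m - 2))"
      unfolding bij_betw_def
    proof
      have "inj_on f ?A" using f by (simp add: bij_betw_def)
      then show "inj_on g (SIGMA q : ?A. {1..Suc (label q)})"
        by (auto simp: inj_on_def g_def prod_eq_iff)
      show "g ` (SIGMA q : ?A. {1..Suc (label q)}) = I_321 m \<times> C_seq (Suc k) (m - 2)"
      proof (intro equalityI subsetI)
        fix r assume "r \<in> g ` (SIGMA q : ?A. {1..Suc (label q)})"
        then obtain q i where qi: "q \<in> ?A" "i \<in> {1..Suc (label q)}" "r = g (q, i)" by blast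
        have "f q \<in> I_321 m \<times> C_seq k (m - 2)" using f qi(1) by (rule bij_betw_apply)
        then show "r \<in> I_321 m \<times> C_seq (Suc k) (m - 2)"
          using qi e[OF qi(1)] by (auto simp: g_def C_seq_snoc)
      next
        fix r assume r: "r \<in> I_321 m \<times> C_seq (Suc k) (m - 2)"
        then have "length (snd r) = Suc k" by (auto simp: C_seq_def)
        then obtain a b where ab: "snd r = a @ [b]" by (cases "snd r" rule: rev_cases) auto
        then have "(fst r, a) \<in> I_321 m \<times> C_seq k (m - 2)" and b: "1 \<le> b" "b \<le> C_end (m - 2) a + 1"
          using r C_seq_snoc[of a b k "m - 2"] by auto
        then obtain q where q: "q \<in> ?A" "f q = (fst r, a)" using f by (metis bij_betw_imp_surj_on imageE)
        then have "r = g (q, nat b)" "nat b \<in> {1..Suc (label q)}"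
          using ab b e[OF q(1)] by (auto simp: g_def prod_eq_iff)
        then show "r \<in> g ` (SIGMA q : ?A. {1..Suc (label q)})" using q(1) by blast
      qed
    qed
    moreover define h where "h = g \<circ> (\<lambda>p. (del p (removable p), label p))"
    ultimately have "bij_betw h ?B (I_321 m \<times> C_seq (Suc k) (m - 2))"
      using removal_bij[of "m + k" k] m by (auto intro: bij_betw_trans)
    moreover have "C_end (m - 2) (snd (h p)) = int (label p)" for p
      by (simp add: h_def g_def C_end_def)
    ultimately show ?case by auto
  qed
  from this[of "n - k"] show ?thesis using assms by fastforce
qed

end
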